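(* Let $1<\lambda\leq e$. Let $(X,d)$ be any free product of real hyperbolic spaces. Then there is a natural embedding $f\colon X\to\mathbf{H}_{\mathbf{R}}^\kappa$ (for some cardinal $\kappa$) such that $$\cosh d\big(f(x),f(y)\big)=\lambda^{d(x,y)}$$ holds for all $x,y\in X$. Moreover, this embedding is equivariant for a representation of $\mathrm{Is}(X)$ to $\mathrm{Is}(\mathbf{H}_{\mathbf{R}}^\kappa)$; that is, there is a homomorphism $\varrho\colon\mathrm{Is}(X)\to\mathrm{Is}(\mathbf{H}_{\mathbf{R}}^\kappa)$ with $f(gx)=\varrho(g)f(x)$ for all $g\in\mathrm{Is}(X)$, $x\in X$.
   Context: $\mathbf{H}_{\mathbf{R}}^\kappa$ denotes the real hyperbolic space of dimension $\kappa$ (any cardinal), of constant curvature $-1$: the projectivisation of the positive vectors of $B(z\oplus u,w\oplus v)=zw-\langle u,v\rangle$ on $\mathbf{R}\oplus H$, $H$ a real Hilbert space of Hilbertian dimension $\kappa$, with $\cosh d(x,y)=|B(X,Y)|/(B(X,X)B(Y,Y))^{1/2}$. $\mathrm{Is}$ denotes the isometry group. Glueing: given metric spaces $X,Y$ with points $x_0\in X$, $y_0\in Y$, the glueing $X\vee Y$ is the quotient of $X\sqcup Y$ identifying $x_0$ with $y_0$, with the original distances on $X$ and on $Y$ and $d(x,y)=d(x,x_0)+d(y_0,y)$ for $x\in X$, $y\in Y$. Free product: given a family $(X_j,x_{j,0})_{j\in J}$ of pointed metric spaces (here: real hyperbolic spaces of arbitrary dimensions) and subsets $X'_j\subseteq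 X_j$ of admissible glueing points (possibly $X'_j=X_j$), start from some $X_j$ and glue a copy of each $X_k$ with $k\neq j$ at each $x_0\in X'_j$ by identifying $x_0$ with $x_{k,0}$. Then repeat this operation on each new space that was attached, in a transfinite sequence of steps conducted over all countable ordinals (taking unions at limit stages). The free product is the subset of points at finite total distance from the original copy of $X_j$, with the resulting distance $d$. *)

theory Defs
  imports "HOL-Analysis.Analysis" "HOL-Algebra.Bij"
begin

section \<open>Real hyperbolic spaces of arbitrary dimension\<close>

text \<open>
  The Hilbert space of Hilbertian dimension \<open>\<kappa>\<close> is modelled as the space of square-summable
  families indexed by a set \<open>K\<close> of cardinality \<open>\<kappa>\<close> (finite or infinite, possibly empty),
  extended by zero outside \<open>K\<close>.
\<close>

type_synonym 'k lvec = "real \<times> ('k \<Rightarrow> real)"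
type_synonym 'k hpoint = "'k lvec set"

definition ell2 :: "'k set \<Rightarrow> ('k \<Rightarrow> real) set" where
  "ell2 K = {u. (\<forall>i. i \<notin> K \<longrightarrow> u i = 0) \<and> (\<lambda>i. (u i)\<^sup>2) summable_on UNIV}"

definition lorentz :: "'k lvec \<Rightarrow> 'k lvec \<Rightarrow> real" where
  "lorentz X Y = fst X * fst Y - (\<Sum>\<^sub>\<infinity>i. snd X i * snd Y i)"

definition proj_class :: "'k lvec \<Rightarrow> 'k hpoint" where
  "proj_class X = {(c * fst X, \<lambda>i. c * snd X i) | c. c \<noteq> 0}"

definition hyp_space :: "'k set \<Rightarrow> 'k hpoint set" where
  "hyp_space K = proj_class ` {X. snd X \<in> ell2 K \<and> lorentz X X > 0}"

text \<open>The distance does not depend on the chosen representatives \<open>X\<close> and \<open>Y\<close>.\<close>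

definition hyp_dist :: "'k hpoint \<Rightarrow> 'k hpoint \<Rightarrow> real" where
  "hyp_dist P Q =
     (let X = (SOME X. X \<in> P); Y = (SOME Y. Y \<in> Q)
      in arcosh (\<bar>lorentz X Y\<bar> / sqrt (lorentz X X * lorentz Y Y)))"


section \<open>Isometry groups\<close>

definition isometry_group :: "'a set \<Rightarrow> ('a \<Rightarrow> 'a \<Rightarrow> real) \<Rightarrow> ('a \<Rightarrow> 'a) monoid" where
  "isometry_group M d =
     (BijGroup M)\<lparr>carrier := {g \<in> Bij M. \<forall>x\<in>M. \<forall>y\<in>M. d (g x) (g y) = d x y}\<rparr>"


section \<open>Free products of pointed metric spaces\<close>

text \<open>
  The spaces \<open>M j\<close> with distance \<open>d j\<close> and base point \<open>b j\<close> are indexed by \<open>j \<in> J\<close>; the admissible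
  glueing points are \<open>A j \<subseteq> M j\<close>, and \<open>j0\<close> is the index of the initial space.

  Every copy of a space occurring in the construction is named by an address. The initial space has
  address \<open>[]\<close>, and \<open>(x, k) # w\<close> is the copy of \<open>M k\<close> glued, along its base point, at the point \<open>x\<close>
  of the copy with address \<open>w\<close>.
\<close>

type_synonym ('j, 'a) address = "('a \<times> 'j) list"
type_synonym ('j, 'a) fp_point = "('j, 'a) address \<times> 'a"

fun space_index :: "'j \<Rightarrow> ('j, 'a) address \<Rightarrow> 'j" where
  "space_index j0 [] = j0"
| "space_index j0 ((x, k) # w) = k"

definition new_copies ::
    "'j set \<Rightarrow> ('j \<Rightarrow> 'a set) \<Rightarrow> 'j \<Rightarrow> ('j, 'a) address set \<Rightarrow> ('j, 'a) address set" where
  "new_copies J A j0 W =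
     {(x, k) # w | x k w. w \<in> W \<and> x \<in> A (space_index j0 w) \<and> k \<in> J \<and> k \<noteq> space_index j0 w}"

text \<open>
  The countable ordinals are the elements of the well-order \<open>cardSuc natLeq\<close>, whose order type is
  the first uncountable ordinal. The uniform recursion below is equivalent to the three clauses
  (zero, successor, limit) proved after it. A copy has only one address, so applying \<open>new_copies\<close> to
  all copies present at some step adds something only for those that have not been processed before.
\<close>

abbreviation omega1 :: "nat set rel" where
  "omega1 \<equiv> cardSuc natLeq"

definition fp_stage ::
    "'j set \<Rightarrow> ('j \<Rightarrow> 'a set) \<Rightarrow> 'j \<Rightarrow> nat set \<Rightarrow> ('j, 'a) address set" where
  "fp_stage J A j0 =
     wfrec (omega1 - Id)
       (\<lambda>S \<alpha>. {[]} \<union> (\<Union>\<beta>\<in>underS omega1 \<alpha>. S \<beta> \<union> new_copies J A j0 (S \<beta>)))"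

lemma Well_order_omega1: "Well_order omega1"
  by (simp add: cardSuc_Card_order card_order_on_well_order_on natLeq_Card_order)

lemma fp_stage_unfold:
  "fp_stage J A j0 \<alpha> =
     {[]} \<union> (\<Union>\<beta>\<in>underS omega1 \<alpha>. fp_stage J A j0 \<beta> \<union> new_copies J A j0 (fp_stage J A j0 \<beta>))"
proof -
  have "wf (omega1 - Id)"
    using Well_order_omega1 by (simp add: well_order_on_def)
  then show ?thesis
    unfolding fp_stage_def
    by (subst wfrec) (auto simp: cut_def underS_def)
qed

lemma fp_stage_zero:
  assumes "underS omega1 \<alpha> = {}"
  shows "fp_stage J A j0 \<alpha> = {[]}"
  unfolding fp_stage_unfold[of J A j0 \<alpha>] assms by simp

lemma fp_stage_succ:
  assumes "underS omega1 \<alpha> = insert \<beta> (underS omega1 \<beta>)"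
  shows "fp_stage J A j0 \<alpha> = fp_stage J A j0 \<beta> \<union> new_copies J A j0 (fp_stage J A j0 \<beta>)"
proof -
  let ?F = "\<lambda>\<gamma>. fp_stage J A j0 \<gamma> \<union> new_copies J A j0 (fp_stage J A j0 \<gamma>)"
  have "fp_stage J A j0 \<alpha> = {[]} \<union> (\<Union>\<gamma>\<in>insert \<beta> (underS omega1 \<beta>). ?F \<gamma>)"
    using fp_stage_unfold[of J A j0 \<alpha>] unfolding assms .
  also have "\<dots> = ({[]} \<union> (\<Union>\<gamma>\<in>underS omega1 \<beta>. ?F \<gamma>)) \<union> ?F \<beta>"
    by blast
  also have "{[]} \<union> (\<Union>\<gamma>\<in>underS omega1 \<beta>. ?F \<gamma>) = fp_stage J A j0 \<beta>"
    using fp_stage_unfold[of J A j0 \<beta>] by (rule sym)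
  finally show ?thesis by blast
qed

lemma fp_stage_limit:
  assumes "underS omega1 \<alpha> \<noteq> {}"
    and "\<And>\<beta>. \<beta> \<in> underS omega1 \<alpha> \<Longrightarrow> \<exists>\<gamma>\<in>underS omega1 \<alpha>. \<beta> \<in> underS omega1 \<gamma>"
  shows "fp_stage J A j0 \<alpha> = (\<Union>\<beta>\<in>underS omega1 \<alpha>. fp_stage J A j0 \<beta>)"
proof -
  have nil: "[] \<in> fp_stage J A j0 \<gamma>" for \<gamma>
    unfolding fp_stage_unfold[of J A j0 \<gamma>] by blast
  have step: "fp_stage J A j0 \<beta> \<union> new_copies J A j0 (fp_stage J A j0 \<beta>) \<subseteq> fp_stage J A j0 \<gamma>"
    if "\<beta> \<in> underS omega1 \<gamma>" for \<beta> \<gamma>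
    unfolding fp_stage_unfold[of J A j0 \<gamma>] using that by blast
  show ?thesis
  proof
    have "fp_stage J A j0 \<beta> \<union> new_copies J A j0 (fp_stage J A j0 \<beta>)
        \<subseteq> (\<Union>\<gamma>\<in>underS omega1 \<alpha>. fp_stage J A j0 \<gamma>)" if "\<beta> \<in> underS omega1 \<alpha>" for \<beta>
      using assms(2)[OF that] step by blast
    moreover have "[] \<in> (\<Union>\<gamma>\<in>underS omega1 \<alpha>. fp_stage J A j0 \<gamma>)"
      using assms(1) nil by blast
    ultimately show "fp_stage J A j0 \<alpha> \<subseteq> (\<Union>\<gamma>\<in>underS omega1 \<alpha>. fp_stage J A j0 \<gamma>)"
      unfolding fp_stage_unfold[of J A j0 \<alpha>] by blast
    show "(\<Union>\<beta>\<in>underS omega1 \<alpha>. fp_stage J A j0 \<beta>) \<subseteq> fp_stage J A j0 \<alpha>"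
      using step by blast
  qed
qed

definition fp_copies :: "'j set \<Rightarrow> ('j \<Rightarrow> 'a set) \<Rightarrow> 'j \<Rightarrow> ('j, 'a) address set" where
  "fp_copies J A j0 = (\<Union>\<alpha>\<in>Field omega1. fp_stage J A j0 \<alpha>)"

text \<open>
  The base point of a glued copy is identified with the glueing point. Hence a point of the quotient
  has exactly one representative \<open>(w, p)\<close> in which \<open>p\<close> is not the base point of a glued copy, and the
  quotient is modelled by these representatives. Since stages at limit ordinals are unions, each
  copy is joined to the initial one by a finite chain of glueings; all total distances are therefore
  finite, and the restriction to points at finite distance from the initial copy removes nothing.
\<close>

definition free_product ::
    "'j set \<Rightarrow> ('j \<Rightarrow> 'a set) \<Rightarrow> ('j \<Rightarrow> 'a) \<Rightarrow> ('j \<Rightarrow> 'a set) \<Rightarrow> 'j \<Rightarrow> ('j, 'a) fp_point set" where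
  "free_product J M b A j0 =
     {(w, p). w \<in> fp_copies J A j0 \<and> p \<in> M (space_index j0 w) \<and>
        (w \<noteq> [] \<longrightarrow> p \<noteq> b (space_index j0 w))}"

text \<open>
  If the copies \<open>w\<close> and \<open>v\<close> differ, one whose address is at least as long as the other's lies
  beyond its base point as seen from the other, so the glueing formula \<open>d(x, y) = d(x, x\<^sub>0) + d(y\<^sub>0, y)\<close> applies there.
\<close>

function copy_dist ::
    "('j \<Rightarrow> 'a \<Rightarrow> 'a \<Rightarrow> real) \<Rightarrow> ('j \<Rightarrow> 'a) \<Rightarrow> 'j \<Rightarrow>
     ('j, 'a) address \<Rightarrow> 'a \<Rightarrow> ('j, 'a) address \<Rightarrow> 'a \<Rightarrow> real" where
  "copy_dist d b j0 w p v q =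
     (if w = v then d (space_index j0 w) p q
      else if length v \<le> length w then
        d (space_index j0 w) p (b (space_index j0 w)) + copy_dist d b j0 (tl w) (fst (hd w)) v q
      else
        copy_dist d b j0 w p (tl v) (fst (hd v)) + d (space_index j0 v) (b (space_index j0 v)) q)"
  by pat_completeness auto
termination
proof (relation "Wellfounded.measure (\<lambda>(d, b, j0, w, p, v, q). length w + length v)", goal_cases)
  case (2 d b j0 w p v q)
  then have "w \<noteq> []" by auto
  then show ?case by simp
qed auto

declare copy_dist.simps [simp del]

text \<open>The glueing formula, for a copy \<open>(x, k) # w\<close> and any point not lying in it or beyond it.\<close>

lemma copy_dist_glue:
  assumes "\<nexists>u. v = u @ (x, k) # w"
  shows "copy_dist d b j0 ((x, k) # w) p v q = d k p (b k) + copy_dist d b j0 w x v q"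
  using assms
proof (induction "length v" arbitrary: v q rule: less_induct)
  case less
  have ne: "(x, k) # w \<noteq> v" using less.prems by auto
  show ?case
  proof (cases "length v \<le> length ((x, k) # w)")
    case True
    then show ?thesis
      using ne unfolding copy_dist.simps[of d b j0 "(x, k) # w" p v q] by simp
  next
    case False
    then obtain y v' where v: "v = y # v'" by (cases v) auto
    have "\<nexists>u. v' = u @ (x, k) # w"
    proof
      assume "\<exists>u. v' = u @ (x, k) # w"
      then obtain u where "v = (y # u) @ (x, k) # w" using v by auto
      with less.prems show False by blast
    qed
    then have IH: "copy_dist d b j0 ((x, k) # w) p v' (fst y) =
        d k p (b k) + copy_dist d b j0 w x v' (fst y)"
      using less.hyps v by simp
    have "copy_dist d b j0 ((x, k) # w) p v q = copy_dist d b j0 ((x, k) # w) p v' (fst y) +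
        d (space_index j0 v) (b (space_index j0 v)) q"
      using False ne v unfolding copy_dist.simps[of d b j0 "(x, k) # w" p v q] by auto
    moreover have "copy_dist d b j0 w x v q = copy_dist d b j0 w x v' (fst y) +
        d (space_index j0 v) (b (space_index j0 v)) q"
      using False v unfolding copy_dist.simps[of d b j0 w x v q] by auto
    ultimately show ?thesis using IH by simp
  qed
qed

definition fp_dist ::
    "('j \<Rightarrow> 'a \<Rightarrow> 'a \<Rightarrow> real) \<Rightarrow> ('j \<Rightarrow> 'a) \<Rightarrow> 'j \<Rightarrow>
     ('j, 'a) fp_point \<Rightarrow> ('j, 'a) fp_point \<Rightarrow> real" where
  "fp_dist d b j0 x y = copy_dist d b j0 (fst x) (snd x) (fst y) (snd y)"

end

theory Submission
  imports Defs
begin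

text \<open>
  For a kernel \<open>\<beta>\<close> and a point \<open>e\<close> with \<open>\<beta> e e = 1\<close>, an embedding \<open>f\<close> with \<open>cosh d(f x, f y) = \<beta> x y\<close>
  exists as soon as \<open>\<beta> x e * \<beta> y e - \<beta> x y\<close> is positive definite. If its image is total, every bijection
  preserving \<open>\<beta>\<close> extends uniquely to the ambient Lorentz space, which gives the representation.

  On a real hyperbolic space, \<open>exp d = 2 cosh d - exp (- d)\<close>. Since \<open>cosh d\<close> is of this kind and
  \<open>exp (- d)\<close> is positive definite, \<open>exp d\<close> is of this kind too, and so are its powers \<open>exp (t d)\<close> for
  \<open>0 < t \<le> 1\<close>. Finally \<open>exp (t d)\<close> is multiplicative across glueing points, so that for the free
  product the positive definite kernels of the individual copies simply add up.
\<close>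

section \<open>Square-summable families as a Hilbert space\<close>

text \<open>A realization \<open>\<phi>\<close> of the kernel by vectors gives the embedding:
  \<open>F x = (\<beta> x e, \<phi> x)\<close> satisfies
  \<open>lor (F x) (F y) = \<beta> x y\<close>, and \<open>F e = (1, 0)\<close>. The bound on the
  base of the exponential becomes t \<le> 1: taking powers expands 1 - (1 - M)^t, whose second
  coefficient t (1 - t) / 2 is negative as soon as t > 1. Glueing fits because the kernel vanishes
  at x, y when \<open>\<beta> x y = \<beta> x e * \<beta> y e\<close>, that is, when e lies between
  them: the two sides are then realized by orthogonal vectors. The obstacle to equivariance is that
  an isometry of the glued space may move e and permute the copies. It preserves
  \<open>\<beta>\<close> but in general not the positive definite kernel, so the induced operator is
  Lorentzian rather than orthogonal, and its boundedness has to be proved. Totality of the image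
  makes it unique, which turns arbitrary choices into a homomorphism.\<close>

typedef 'i l2 = "{u :: 'i \<Rightarrow> real. (\<lambda>i. (u i)\<^sup>2) summable_on UNIV}"
  morphisms coord Abs_l2
  by (rule exI[of _ "\<lambda>_. 0"]) simp

setup_lifting type_definition_l2

lemma coord_square_summable: "(\<lambda>i. (coord u i)\<^sup>2) summable_on UNIV"
  using coord[of u] by simp

lemma summable_mult_square_summable:
  fixes u v :: "'i \<Rightarrow> real"
  assumes "(\<lambda>i. (u i)\<^sup>2) summable_on UNIV" and "(\<lambda>i. (v i)\<^sup>2) summable_on UNIV"
  shows "(\<lambda>i. u i * v i) summable_on UNIV"
proof -
  have "(\<lambda>i. norm (u i * v i)) summable_on UNIV"
    using abs_summable_product[of u UNIV v] assms by (simp add: power2_eq_square)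
  then show ?thesis by (rule abs_summable_summable)
qed

lemma summable_coord_mult: "(\<lambda>i. coord u i * coord v i) summable_on UNIV"
  by (intro summable_mult_square_summable coord_square_summable)

lemma square_summable_add:
  fixes u v :: "'i \<Rightarrow> real"
  assumes "(\<lambda>i. (u i)\<^sup>2) summable_on UNIV" and "(\<lambda>i. (v i)\<^sup>2) summable_on UNIV"
  shows "(\<lambda>i. (u i + v i)\<^sup>2) summable_on UNIV"
proof -
  have "(\<lambda>i. (u i)\<^sup>2 + ((v i)\<^sup>2 + 2 * (u i * v i))) summable_on UNIV"
    by (intro summable_on_add summable_on_cmult_right summable_mult_square_summable assms)
  then show ?thesis by (simp add: power2_sum algebra_simps)
qed

lemma square_summable_diff:
  fixes u v :: "'i \<Rightarrow> real"
  assumes "(\<lambda>i. (u i)\<^sup>2) summable_on UNIV" and "(\<lambda>i. (v i)\<^sup>2) summable_on UNIV"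
  shows "(\<lambda>i. (u i - v i)\<^sup>2) summable_on UNIV"
  using square_summable_add[of u "\<lambda>i. - v i"] assms by simp

lemma l2_eqI: "(\<And>i. coord u i = coord v i) \<Longrightarrow> u = v"
  by (simp add: coord_inject[symmetric] fun_eq_iff)

instantiation l2 :: (type) real_vector
begin

lift_definition zero_l2 :: "'a l2" is "\<lambda>_. 0" by simp
lift_definition plus_l2 :: "'a l2 \<Rightarrow> 'a l2 \<Rightarrow> 'a l2" is "\<lambda>u v i. u i + v i"
  by (rule square_summable_add)
lift_definition uminus_l2 :: "'a l2 \<Rightarrow> 'a l2" is "\<lambda>u i. - u i" by simp
lift_definition minus_l2 :: "'a l2 \<Rightarrow> 'a l2 \<Rightarrow> 'a l2" is "\<lambda>u v i. u i - v i"
  by (rule square_summable_diff)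
lift_definition scaleR_l2 :: "real \<Rightarrow> 'a l2 \<Rightarrow> 'a l2" is "\<lambda>c u i. c * u i"
  unfolding power_mult_distrib by (rule summable_on_cmult_right)

lemma coord_simps [simp]:
  "coord 0 i = 0" "coord (u + v) i = coord u i + coord v i" "coord (- u) i = - coord u i"
  "coord (u - v) i = coord u i - coord v i" "coord (c *\<^sub>R u) i = c * coord u i"
  by (simp_all add: zero_l2.rep_eq plus_l2.rep_eq uminus_l2.rep_eq minus_l2.rep_eq scaleR_l2.rep_eq)

instance
  by standard (rule l2_eqI; simp add: algebra_simps)+

end

instantiation l2 :: (type) real_inner
begin

lift_definition inner_l2 :: "'a l2 \<Rightarrow> 'a l2 \<Rightarrow> real" is "\<lambda>u v. \<Sum>\<^sub>\<infinity>i. u i * v i" .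

definition norm_l2 :: "'a l2 \<Rightarrow> real" where "norm_l2 u = sqrt (inner u u)"
definition dist_l2 :: "'a l2 \<Rightarrow> 'a l2 \<Rightarrow> real" where "dist_l2 u v = norm (u - v)"
definition sgn_l2 :: "'a l2 \<Rightarrow> 'a l2" where "sgn_l2 u = u /\<^sub>R norm u"
definition uniformity_l2 :: "('a l2 \<times> 'a l2) filter"
  where "uniformity_l2 = (INF e\<in>{0<..}. principal {(x, y). dist x y < e})"
definition open_l2 :: "'a l2 set \<Rightarrow> bool"
  where "open_l2 U = (\<forall>x\<in>U. eventually (\<lambda>(x', y). x' = x \<longrightarrow> y \<in> U) uniformity)"

instance
proof
  fix u v w :: "'a l2" and a :: real
  show "inner u v = inner v u" by transfer (simp add: mult.commute)
  show "inner (u + v) w = inner u w + inner v w"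
  proof transfer
    fix u v w :: "'a \<Rightarrow> real"
    assume "(\<lambda>i. (u i)\<^sup>2) summable_on UNIV" "(\<lambda>i. (v i)\<^sup>2) summable_on UNIV"
      "(\<lambda>i. (w i)\<^sup>2) summable_on UNIV"
    then have "(\<lambda>i. u i * w i) summable_on UNIV" "(\<lambda>i. v i * w i) summable_on UNIV"
      by (auto intro: summable_mult_square_summable)
    then show "(\<Sum>\<^sub>\<infinity>i. (u i + v i) * w i) = (\<Sum>\<^sub>\<infinity>i. u i * w i) + (\<Sum>\<^sub>\<infinity>i. v i * w i)"
      by (simp add: distrib_right infsum_add)
  qed
  show "inner (a *\<^sub>R u) v = a * inner u v"
    by transfer (simp add: mult.assoc infsum_cmult_right')
  show "0 \<le> inner u u" by transfer (simp add: infsum_nonneg)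
  show "inner u u = 0 \<longleftrightarrow> u = 0"
  proof transfer
    fix u :: "'a \<Rightarrow> real" assume u: "(\<lambda>i. (u i)\<^sup>2) summable_on UNIV"
    have "u i = 0" if "(\<Sum>\<^sub>\<infinity>i. u i * u i) = 0" for i
      using nonneg_infsum_le_0D[of "\<lambda>i. u i * u i" UNIV i] that u by (auto simp: power2_eq_square)
    then show "(\<Sum>\<^sub>\<infinity>i. u i * u i) = 0 \<longleftrightarrow> u = (\<lambda>_. 0)"
      by (metis (mono_tags, lifting) ext infsum_0 mult_zero_left)
  qed
qed (simp_all add: norm_l2_def dist_l2_def sgn_l2_def uniformity_l2_def open_l2_def)

end

lemma inner_l2_coord: "inner u v = (\<Sum>\<^sub>\<infinity>i. coord u i * coord v i)"
  by transfer simp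

lemma sum_coord_square_le: "finite F \<Longrightarrow> (\<Sum>i\<in>F. (coord u i)\<^sup>2) \<le> (norm u)\<^sup>2"
  unfolding power2_norm_eq_inner inner_l2_coord
  using finite_sum_le_infsum[OF coord_square_summable[of u], of F]
  by (simp add: power2_eq_square)

lemma abs_coord_le_norm: "\<bar>coord u i\<bar> \<le> norm u"
  using sum_coord_square_le[of "{i}" u] by (simp add: abs_le_square_iff[symmetric])

lemma square_summable_bounded:
  fixes u :: "'i \<Rightarrow> real"
  assumes "\<And>F. finite F \<Longrightarrow> (\<Sum>i\<in>F. (u i)\<^sup>2) \<le> C"
  shows "(\<lambda>i. (u i)\<^sup>2) summable_on UNIV" "(\<Sum>\<^sub>\<infinity>i. (u i)\<^sup>2) \<le> C"
proof -
  show "(\<lambda>i. (u i)\<^sup>2) summable_on UNIV"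
    by (rule nonneg_bdd_above_summable_on) (auto intro!: bdd_aboveI2 assms)
  then show "(\<Sum>\<^sub>\<infinity>i. (u i)\<^sup>2) \<le> C"
    by (rule infsum_le_finite_sums) (auto intro: assms)
qed

text \<open>The limit is taken coordinatewise. Only finite sums of squares pass to it directly, so
  the Cauchy bound is kept uniform over finite index sets; this gives square-summability as well as
  convergence in norm.\<close>

instance l2 :: (type) complete_space
proof
  fix U :: "nat \<Rightarrow> 'a l2"
  assume "Cauchy U"
  have "Cauchy (\<lambda>n. coord (U n) i)" for i
  proof (rule CauchyI)
    fix e :: real assume "0 < e"
    then obtain N where "\<And>m n. m \<ge> N \<Longrightarrow> n \<ge> N \<Longrightarrow> norm (U m - U n) < e"
      using CauchyD[OF \<open>Cauchy U\<close>] by blast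
    moreover have "\<bar>coord (U m) i - coord (U n) i\<bar> \<le> norm (U m - U n)" for m n
      using abs_coord_le_norm[of "U m - U n" i] by simp
    ultimately show "\<exists>N. \<forall>m\<ge>N. \<forall>n\<ge>N. norm (coord (U m) i - coord (U n) i) < e"
      by (metis order.strict_trans1 real_norm_def)
  qed
  then obtain u where u: "\<And>i. (\<lambda>n. coord (U n) i) \<longlonglongrightarrow> u i"
    unfolding Cauchy_convergent_iff convergent_def by metis
  have tail: "\<exists>N. \<forall>n\<ge>N. \<forall>F. finite F \<longrightarrow> (\<Sum>i\<in>F. (u i - coord (U n) i)\<^sup>2) \<le> e\<^sup>2" if "0 < e" for e
  proof -
    obtain N where N: "\<And>m n. m \<ge> N \<Longrightarrow> n \<ge> N \<Longrightarrow> norm (U m - U n) < e"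
      using CauchyD[OF \<open>Cauchy U\<close> \<open>0 < e\<close>] by blast
    have "(\<Sum>i\<in>F. (u i - coord (U n) i)\<^sup>2) \<le> e\<^sup>2" if "n \<ge> N" "finite F" for n F
    proof (rule LIMSEQ_le_const2)
      show "(\<lambda>m. \<Sum>i\<in>F. (coord (U m) i - coord (U n) i)\<^sup>2) \<longlonglongrightarrow> (\<Sum>i\<in>F. (u i - coord (U n) i)\<^sup>2)"
        by (intro tendsto_intros u)
      have "(\<Sum>i\<in>F. (coord (U m) i - coord (U n) i)\<^sup>2) \<le> e\<^sup>2" if "m \<ge> N" for m
        using sum_coord_square_le[OF \<open>finite F\<close>, of "U m - U n"]
          power_mono[of "norm (U m - U n)" e 2] N[OF that \<open>n \<ge> N\<close>] by simp
      then show "\<exists>N. \<forall>m\<ge>N. (\<Sum>i\<in>F. (coord (U m) i - coord (U n) i)\<^sup>2) \<le> e\<^sup>2" by blast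
    qed
    then show ?thesis by blast
  qed
  obtain N where "\<And>F. finite F \<Longrightarrow> (\<Sum>i\<in>F. (u i - coord (U N) i)\<^sup>2) \<le> 1\<^sup>2"
    using tail[of 1] by auto
  then have "(\<lambda>i. (u i - coord (U N) i)\<^sup>2) summable_on UNIV"
    by (rule square_summable_bounded)
  from square_summable_add[OF this coord_square_summable[of "U N"]]
  have "(\<lambda>i. (u i)\<^sup>2) summable_on UNIV" by simp
  then obtain V where V: "coord V = u" using Abs_l2_inverse[of u] by auto
  have "U \<longlonglongrightarrow> V"
  proof (rule metric_LIMSEQ_I)
    fix e :: real assume "0 < e"
    \<comment> \<open>Limits preserve only weak inequalities; half of \<open>e\<close> leaves room
      for the strict one.\<close>
    then obtain N where N: "\<And>n F. n \<ge> N \<Longrightarrow> finite F \<Longrightarrow> (\<Sum>i\<in>F. (u i - coord (U n) i)\<^sup>2) \<le> (e/2)\<^sup>2"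
      using tail[of "e/2"] by auto
    have "dist (U n) V < e" if "n \<ge> N" for n
    proof -
      have "(norm (V - U n))\<^sup>2 \<le> (e/2)\<^sup>2"
        using square_summable_bounded(2)[OF N[OF that]]
        unfolding power2_norm_eq_inner inner_l2_coord by (simp add: V flip: power2_eq_square)
      then have "norm (V - U n) \<le> e/2"
        using \<open>0 < e\<close> by (simp add: power2_le_iff_abs_le)
      then show ?thesis using \<open>0 < e\<close> by (simp add: dist_norm norm_minus_commute)
    qed
    then show "\<exists>N. \<forall>n\<ge>N. dist (U n) V < e" by blast
  qed
  then show "convergent U" by (auto simp: convergent_def)
qed

lift_definition unit_l2 :: "'i \<Rightarrow> 'i l2" is "\<lambda>i j. if j = i then 1 else 0"
proof -
  fix i :: 'i
  have "(\<lambda>j. (if j = i then 1 else 0 :: real)\<^sup>2) summable_on {i}" by simp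
  then show "(\<lambda>j. (if j = i then 1 else 0 :: real)\<^sup>2) summable_on UNIV"
    by (subst summable_on_cong_neutral[where T = "{i}"]) auto
qed

lemma coord_unit: "coord (unit_l2 i) j = (if j = i then 1 else 0)"
  by transfer simp

lemma inner_unit_left: "inner (unit_l2 i) u = coord u i"
proof -
  have "inner (unit_l2 i) u = (\<Sum>\<^sub>\<infinity>j\<in>{i}. coord u j)"
    unfolding inner_l2_coord by (rule infsum_cong_neutral) (auto simp: coord_unit)
  then show ?thesis by simp
qed

lemma inner_unit_right: "inner u (unit_l2 i) = coord u i"
  by (metis inner_commute inner_unit_left)

text \<open>The counterpart of \<open>ell2\<close>: spaces over different index sets become closed
  subspaces of one type, to which closures, spans and bounded operators apply.\<close>

definition supp_l2 :: "'i set \<Rightarrow> 'i l2 set" where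
  "supp_l2 I = {u. \<forall>i. i \<notin> I \<longrightarrow> coord u i = 0}"

lemma subspace_supp_l2: "subspace (supp_l2 I)"
  by (auto simp: subspace_def supp_l2_def)

lemma closed_supp_l2: "closed (supp_l2 I)"
proof -
  have "supp_l2 I = (\<Inter>i\<in>-I. {u. inner (unit_l2 i) u = 0})"
    by (auto simp: supp_l2_def inner_unit_left)
  moreover have "closed {u. inner (unit_l2 i) u = 0}" for i :: 'a
    by (intro closed_Collect_eq continuous_intros)
  ultimately show ?thesis by auto
qed

lemma coord_ell2: "coord u \<in> ell2 K \<longleftrightarrow> u \<in> supp_l2 K"
  by (auto simp: ell2_def supp_l2_def coord_square_summable)

lemma ell2_coordE:
  assumes "v \<in> ell2 K"
  obtains u where "u \<in> supp_l2 K" "v = coord u"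
proof
  from assms have "coord (Abs_l2 v) = v" by (simp add: ell2_def Abs_l2_inverse)
  then show "v = coord (Abs_l2 v)" "Abs_l2 v \<in> supp_l2 K"
    using assms by (simp_all flip: coord_ell2)
qed

section \<open>Positive definite kernels\<close>

text \<open>Positivity of kernels is stated for tuples indexed by \<open>i < n\<close>, repetitions
  allowed; this brings elements of a span into the same form.\<close>

lemma span_image_eq_sum:
  fixes f :: "'a \<Rightarrow> 'b :: real_vector"
  assumes "v \<in> span (f ` X)"
  obtains n :: nat and x c where "\<And>i. i < n \<Longrightarrow> x i \<in> X" "v = (\<Sum>i<n. c i *\<^sub>R f (x i))"
proof -
  have "\<exists>(n::nat) x c. (\<forall>i<n. x i \<in> X) \<and> v = (\<Sum>i<n. c i *\<^sub>R f (x i))"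
    using assms
  proof (induction rule: span_induct_alt)
    case base
    show ?case by (rule exI[of _ 0]) simp
  next
    case (step a u v)
    then obtain n :: nat and x c where n: "\<forall>i<n. x i \<in> X" "v = (\<Sum>i<n. c i *\<^sub>R f (x i))" by blast
    from step obtain y where "y \<in> X" "u = f y" by blast
    with n have "(\<forall>i<Suc n. (x(n := y)) i \<in> X) \<and>
        a *\<^sub>R u + v = (\<Sum>i<Suc n. (c(n := a)) i *\<^sub>R f ((x(n := y)) i))"
      by (auto simp: less_Suc_eq)
    then show ?case by blast
  qed
  then show thesis using that by blast
qed

text \<open>The extension principle behind orthogonality, Lorentz invariance and equality of
  operators below: each is a closed linear condition, to be checked on generators only.\<close>

lemma closure_span_minimal:
  assumes "subspace S" "closed S" "A \<subseteq> S"
  shows "closure (span A) \<subseteq> S"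
  by (intro closure_minimal span_minimal assms)

lemma subspace_closure_span:
  fixes A :: "'h :: real_normed_vector set"
  shows "subspace (closure (span A))"
proof -
  have "x + y \<in> closure (span A)" if "x \<in> closure (span A)" "y \<in> closure (span A)" for x y
  proof -
    from that obtain s t where "\<And>n. s n \<in> span A" "s \<longlonglongrightarrow> x" "\<And>n. t n \<in> span A" "t \<longlonglongrightarrow> y"
      by (auto simp: closure_sequential)
    then show ?thesis
      by (auto simp: closure_sequential intro!: exI[of _ "\<lambda>n. s n + t n"] tendsto_add span_add)
  qed
  moreover have "c *\<^sub>R x \<in> closure (span A)" if "x \<in> closure (span A)" for c x
  proof -
    from that obtain s where "\<And>n. s n \<in> span A" "s \<longlonglongrightarrow> x"
      by (auto simp: closure_sequential)
    then show ?thesis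
      by (auto simp: closure_sequential intro!: exI[of _ "\<lambda>n. c *\<^sub>R s n"] tendsto_intros span_scale)
  qed
  ultimately show ?thesis
    using closure_subset[of "span A"] span_zero[of A] by (auto simp: subspace_def)
qed

text \<open>The representing vector is the limit of a minimizing sequence of \<open>\<parallel>s\<parallel>\<^sup>2 - 2 L(s)\<close>.\<close>

lemma Riesz_representation_family:
  fixes \<phi> :: "'a \<Rightarrow> 'h :: {real_inner, complete_space}" and L :: "'a \<Rightarrow> real"
  assumes bound: "\<And>(n::nat) x c. (\<And>i. i < n \<Longrightarrow> x i \<in> X) \<Longrightarrow>
      (\<Sum>i<n. c i * L (x i))\<^sup>2 \<le> C * (norm (\<Sum>i<n. c i *\<^sub>R \<phi> (x i)))\<^sup>2"
    and "0 \<le> C"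
  obtains h where "h \<in> closure (span (\<phi> ` X))" "(norm h)\<^sup>2 \<le> C" "\<And>x. x \<in> X \<Longrightarrow> inner h (\<phi> x) = L x"
proof -
  \<comment> \<open>The graph of \<open>L\<close> over the span. Working with pairs avoids showing
    beforehand that \<open>L\<close> is well defined on linear combinations.\<close>
  define E where "E = span ((\<lambda>x. (\<phi> x, L x)) ` X)"
  define Q :: "'h \<times> real \<Rightarrow> real" where "Q e = (norm (fst e))\<^sup>2 - 2 * snd e" for e
  have E: "subspace E" by (simp add: E_def)
  have fst_E: "fst e \<in> span (\<phi> ` X)" if "e \<in> E" for e
  proof -
    have "linear (fst :: 'h \<times> real \<Rightarrow> 'h)" by (simp add: linear_fst)
    then have "fst ` E = span (fst ` (\<lambda>x. (\<phi> x, L x)) ` X)"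
      unfolding E_def by (rule linear_span_image[symmetric])
    then show ?thesis using that by (auto simp: image_image)
  qed
  have E_bound: "(snd e)\<^sup>2 \<le> C * (norm (fst e))\<^sup>2" if "e \<in> E" for e
  proof -
    from that obtain n :: nat and x c
      where n: "\<And>i. i < n \<Longrightarrow> x i \<in> X" "e = (\<Sum>i<n. c i *\<^sub>R (\<phi> (x i), L (x i)))"
      unfolding E_def by (rule span_image_eq_sum) blast
    then have "fst e = (\<Sum>i<n. c i *\<^sub>R \<phi> (x i))" "snd e = (\<Sum>i<n. c i * L (x i))"
      by (simp_all add: fst_sum snd_sum)
    then show ?thesis using bound[OF n(1)] by simp
  qed
  have Q_ge: "- C \<le> Q e" if "e \<in> E" for e
  proof -
    have "\<bar>snd e\<bar> \<le> sqrt C * norm (fst e)"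
      using real_sqrt_le_mono[OF E_bound[OF that]] by (simp add: real_sqrt_mult)
    moreover have "0 \<le> (norm (fst e))\<^sup>2 + C - 2 * (sqrt C * norm (fst e))"
      using zero_le_power2[of "norm (fst e) - sqrt C"] \<open>0 \<le> C\<close>
      by (simp add: power2_diff mult_ac)
    ultimately show ?thesis by (simp add: Q_def)
  qed
  define m where "m = Inf (Q ` E)"
  have bdd: "bdd_below (Q ` E)" using Q_ge by (rule bdd_belowI2)
  have ne: "Q ` E \<noteq> {}" using subspace_0[OF E] by blast
  have m_le: "m \<le> Q e" if "e \<in> E" for e
    unfolding m_def using bdd that by (simp add: cINF_lower)
  have "\<exists>e\<in>E. Q e < m + 1 / Suc k" for k
    using cInf_lessD[OF ne, of "m + 1 / Suc k"] unfolding m_def by auto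
  then obtain s where s: "\<And>k. s k \<in> E" "\<And>k. Q (s k) < m + 1 / Suc k" by metis
  define u where "u = (\<lambda>k. fst (s k))"
  \<comment> \<open>The parallelogram identity at the midpoint, where \<open>Q\<close> is still at
    least \<open>m\<close>; the linear terms cancel.\<close>
  have dist_le: "(norm (fst e - fst e'))\<^sup>2 \<le> 2 * (Q e - m) + 2 * (Q e' - m)"
    if "e \<in> E" "e' \<in> E" for e e'
  proof -
    have "m \<le> Q ((1/2) *\<^sub>R (e + e'))"
      using that by (intro m_le subspace_mul subspace_add E)
    moreover have "Q ((1/2) *\<^sub>R (e + e')) = (Q e + Q e') / 2 - (norm (fst e - fst e'))\<^sup>2 / 4"
      by (simp add: Q_def power2_norm_eq_inner inner_add_left inner_add_right inner_diff_left
          inner_diff_right inner_commute field_simps)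
    ultimately have "(norm (fst e - fst e'))\<^sup>2 / 4 \<le> (Q e + Q e') / 2 - m" by linarith
    then show ?thesis by (simp add: field_simps)
  qed
  have Q_lim: "(\<lambda>k. Q (s k)) \<longlonglongrightarrow> m"
  proof (rule real_tendsto_sandwich)
    show "\<forall>\<^sub>F k in sequentially. m \<le> Q (s k)" by (simp add: m_le s)
    show "\<forall>\<^sub>F k in sequentially. Q (s k) \<le> m + 1 / Suc k"
      by (intro always_eventually allI less_imp_le s)
    show "(\<lambda>k. m + 1 / Suc k) \<longlonglongrightarrow> m"
      using tendsto_add[OF tendsto_const LIMSEQ_Suc[OF lim_1_over_n], of m] by simp
  qed simp
  have "Cauchy u"
  proof (rule CauchyI)
    fix \<epsilon> :: real assume "0 < \<epsilon>"
    \<comment> \<open>Two excesses of \<open>\<epsilon>\<^sup>2 / 4\<close>, each doubled by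
      \<open>dist_le\<close>, add up to \<open>\<epsilon>\<^sup>2\<close>.\<close>
    then have "\<forall>\<^sub>F k in sequentially. Q (s k) < m + \<epsilon>\<^sup>2 / 4"
      using Q_lim by (intro order_tendstoD(2)) auto
    then obtain N where N: "\<And>k. k \<ge> N \<Longrightarrow> Q (s k) < m + \<epsilon>\<^sup>2 / 4"
      by (auto simp: eventually_sequentially)
    have "norm (u j - u k) < \<epsilon>" if "j \<ge> N" "k \<ge> N" for j k
    proof -
      have "(norm (u j - u k))\<^sup>2 < \<epsilon>\<^sup>2"
        using dist_le[OF s(1) s(1), of j k] N[OF that(1)] N[OF that(2)] unfolding u_def by argo
      then show ?thesis using \<open>0 < \<epsilon>\<close> by (simp add: power_less_imp_less_base)
    qed
    then show "\<exists>N. \<forall>j\<ge>N. \<forall>k\<ge>N. norm (u j - u k) < \<epsilon>" by blast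
  qed
  then obtain h where h: "u \<longlonglongrightarrow> h"
    by (auto simp: Cauchy_convergent_iff convergent_def)
  have "h \<in> closure (span (\<phi> ` X))"
    using h fst_E[OF s(1)] by (auto simp: closure_sequential u_def intro!: exI[of _ u])
  have h_E: "inner h (fst e) = snd e" if "e \<in> E" for e
  proof -
    \<comment> \<open>First variation: moving a minimizing sequence by \<open>t *\<^sub>R e\<close>
      cannot bring \<open>Q\<close> below \<open>m\<close>.\<close>
    have var: "0 \<le> 2 * t * (inner h (fst e) - snd e) + t\<^sup>2 * (norm (fst e))\<^sup>2" for t
    proof (rule LIMSEQ_le_const)
      show "(\<lambda>k. (Q (s k) - m) + (2 * t * (inner (u k) (fst e) - snd e) + t\<^sup>2 * (norm (fst e))\<^sup>2))
          \<longlonglongrightarrow> 2 * t * (inner h (fst e) - snd e) + t\<^sup>2 * (norm (fst e))\<^sup>2"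
        by (rule tendsto_eq_intros Q_lim h refl | simp)+
      have "0 \<le> (Q (s k) - m) + (2 * t * (inner (u k) (fst e) - snd e) + t\<^sup>2 * (norm (fst e))\<^sup>2)" for k
      proof -
        have "m \<le> Q (s k + t *\<^sub>R e)"
          using that s by (intro m_le subspace_mul subspace_add E)
        also have "\<dots> = Q (s k) + (2 * t * (inner (u k) (fst e) - snd e) + t\<^sup>2 * (norm (fst e))\<^sup>2)"
          unfolding Q_def u_def power2_norm_eq_inner
          by (simp add: algebra_simps inner_commute power2_eq_square)
        finally show ?thesis by simp
      qed
      then show "\<exists>N. \<forall>n\<ge>N. 0 \<le> (Q (s n) - m) + (2 * t * (inner (u n) (fst e) - snd e) + t\<^sup>2 * (norm (fst e))\<^sup>2)"
        by blast
    qed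
    define d where "d = inner h (fst e) - snd e"
    \<comment> \<open>The summand 1 keeps the denominator of the test value
      \<open>t = - d / r\<close> positive even if \<open>fst e = 0\<close>.\<close>
    define r where "r = (norm (fst e))\<^sup>2 + 1"
    have "r > 0" by (simp add: r_def add_nonneg_pos)
    have "0 \<le> 2 * (- d / r) * d + (- d / r)\<^sup>2 * (r - 1)"
      using var[of "- d / r"] by (simp add: d_def r_def)
    also have "\<dots> = - (d\<^sup>2 / r) - d\<^sup>2 / r\<^sup>2"
      using \<open>r > 0\<close> by (simp add: field_simps power2_eq_square)
    finally have "d\<^sup>2 / r + d\<^sup>2 / r\<^sup>2 \<le> 0" by simp
    moreover have "0 \<le> d\<^sup>2 / r" "0 \<le> d\<^sup>2 / r\<^sup>2" using \<open>r > 0\<close> by simp_all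
    ultimately have "d\<^sup>2 / r = 0" by linarith
    then show ?thesis using \<open>r > 0\<close> by (simp add: d_def)
  qed
  \<comment> \<open>\<open>h\<close> is tested against its own approximants, on which
    \<open>inner h\<close> is already known to be \<open>L\<close>.\<close>
  have "(norm h)\<^sup>2 \<le> sqrt C * norm h"
  proof (rule LIMSEQ_le)
    show "(\<lambda>k. inner h (u k)) \<longlonglongrightarrow> (norm h)\<^sup>2"
      unfolding power2_norm_eq_inner by (intro tendsto_intros h)
    show "(\<lambda>k. sqrt C * norm (u k)) \<longlonglongrightarrow> sqrt C * norm h" by (intro tendsto_intros h)
    have "inner h (u k) \<le> sqrt C * norm (u k)" for k
      using real_sqrt_le_mono[OF E_bound[OF s(1)], of k] h_E[OF s(1), of k]
      by (simp add: real_sqrt_mult u_def)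
    then show "\<exists>N. \<forall>n\<ge>N. inner h (u n) \<le> sqrt C * norm (u n)" by blast
  qed
  then have "norm h \<le> sqrt C"
    using \<open>0 \<le> C\<close> by (cases "norm h = 0") (auto simp: power2_eq_square)
  then have "(norm h)\<^sup>2 \<le> C"
    using \<open>0 \<le> C\<close> by (metis norm_ge_zero power_mono real_sqrt_pow2)
  moreover have "inner h (\<phi> x) = L x" if "x \<in> X" for x
    using h_E[of "(\<phi> x, L x)"] that by (auto simp: E_def intro: span_base)
  ultimately show thesis
    using that \<open>h \<in> closure (span (\<phi> ` X))\<close> by blast
qed

text \<open>Points of a tuple may repeat, which frees the proofs from distinctness conditions.
  Symmetry is demanded separately because real coefficients do not detect an antisymmetric
  part.\<close>

definition pd_kernel :: "'a set \<Rightarrow> ('a \<Rightarrow> 'a \<Rightarrow> real) \<Rightarrow> bool" where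
  "pd_kernel X N \<longleftrightarrow> (\<forall>x\<in>X. \<forall>y\<in>X. N x y = N y x) \<and>
     (\<forall>(n::nat) x c. (\<forall>i<n. x i \<in> X) \<longrightarrow> 0 \<le> (\<Sum>i<n. \<Sum>j<n. c i * c j * N (x i) (x j)))"

lemma pd_kernelI:
  assumes "\<And>x y. x \<in> X \<Longrightarrow> y \<in> X \<Longrightarrow> N x y = N y x"
    and "\<And>(n::nat) x c. (\<And>i. i < n \<Longrightarrow> x i \<in> X) \<Longrightarrow> 0 \<le> (\<Sum>i<n. \<Sum>j<n. c i * c j * N (x i) (x j))"
  shows "pd_kernel X N"
  using assms by (simp add: pd_kernel_def)

lemma pd_kernel_sym: "pd_kernel X N \<Longrightarrow> x \<in> X \<Longrightarrow> y \<in> X \<Longrightarrow> N x y = N y x"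
  by (simp add: pd_kernel_def)

lemma pd_kernel_sum_nonneg:
  fixes n :: nat
  shows "pd_kernel X N \<Longrightarrow> (\<And>i. i < n \<Longrightarrow> x i \<in> X) \<Longrightarrow> 0 \<le> (\<Sum>i<n. \<Sum>j<n. c i * c j * N (x i) (x j))"
  by (simp add: pd_kernel_def)

lemma pd_kernel_diag_nonneg: "pd_kernel X N \<Longrightarrow> x \<in> X \<Longrightarrow> 0 \<le> N x x"
  using pd_kernel_sum_nonneg[of X N 1 "\<lambda>_. x" "\<lambda>_. 1"] by simp

text \<open>Adjoining one point with a free weight \<open>s\<close> turns positivity into a
  condition on a quadratic polynomial in \<open>s\<close>.\<close>

lemma quadratic_form_Suc:
  fixes n :: nat and s :: real
  assumes sym: "\<And>i. i < n \<Longrightarrow> N (x i) y = N y (x i)"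
  shows "(\<Sum>i<Suc n. \<Sum>j<Suc n. (c(n := s)) i * (c(n := s)) j * N ((x(n := y)) i) ((x(n := y)) j)) =
    (\<Sum>i<n. \<Sum>j<n. c i * c j * N (x i) (x j)) + 2 * s * (\<Sum>i<n. c i * N y (x i)) + s\<^sup>2 * N y y"
proof -
  have eq: "(\<Sum>i<n. c i * s * N (x i) y) = (\<Sum>i<n. s * c i * N y (x i))"
    by (rule sum.cong) (simp_all add: sym)
  have "(\<Sum>i<Suc n. \<Sum>j<Suc n. (c(n := s)) i * (c(n := s)) j * N ((x(n := y)) i) ((x(n := y)) j)) =
      (\<Sum>i<n. \<Sum>j<n. c i * c j * N (x i) (x j)) + (\<Sum>i<n. c i * s * N (x i) y)
      + ((\<Sum>i<n. s * c i * N y (x i)) + s * s * N y y)"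
    by (simp add: sum.distrib)
  then show ?thesis unfolding eq
    by (simp add: sum_distrib_left power2_eq_square algebra_simps)
qed

text \<open>A quadratic polynomial that is nowhere negative has nonpositive discriminant. It is
  proved from the kernel alone, since it supplies the bound from which
  \<open>pd_kernel_realization\<close> obtains vectors in the first place.\<close>

lemma pd_kernel_Cauchy_Schwarz:
  fixes n :: nat
  assumes N: "pd_kernel X N" and "y \<in> X" and x: "\<And>i. i < n \<Longrightarrow> x i \<in> X"
  shows "(\<Sum>i<n. c i * N y (x i))\<^sup>2 \<le> N y y * (\<Sum>i<n. \<Sum>j<n. c i * c j * N (x i) (x j))"
proof -
  define q where "q = (\<Sum>i<n. \<Sum>j<n. c i * c j * N (x i) (x j))"
  define p where "p = (\<Sum>i<n. c i * N y (x i))"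
  have pos: "0 \<le> q + 2 * s * p + s\<^sup>2 * N y y" for s
  proof -
    have "0 \<le> (\<Sum>i<Suc n. \<Sum>j<Suc n. (c(n := s)) i * (c(n := s)) j * N ((x(n := y)) i) ((x(n := y)) j))"
      by (rule pd_kernel_sum_nonneg[OF N]) (use \<open>y \<in> X\<close> x in \<open>auto simp: less_Suc_eq\<close>)
    also have "\<dots> = q + 2 * s * p + s\<^sup>2 * N y y"
      unfolding q_def p_def
      by (rule quadratic_form_Suc) (rule pd_kernel_sym[OF N x \<open>y \<in> X\<close>])
    finally show ?thesis .
  qed
  have "p\<^sup>2 \<le> N y y * q"
  proof (cases "N y y = 0")
    case True
    have "p = 0"
    proof (rule ccontr)
      assume "p \<noteq> 0"
      \<comment> \<open>At this \<open>s\<close> the polynomial, linear because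
        \<open>N y y = 0\<close>, takes the value -1.\<close>
      then show False using pos[of "- (q + 1) / (2 * p)"] True by (simp add: field_simps)
    qed
    then show ?thesis using True by simp
  next
    case False
    then have "0 < N y y" using pd_kernel_diag_nonneg[OF N \<open>y \<in> X\<close>] by simp
    have "0 \<le> q - p\<^sup>2 / N y y"
      using pos[of "- p / N y y"] \<open>0 < N y y\<close> by (simp add: power2_eq_square field_simps)
    then show ?thesis using \<open>0 < N y y\<close> by (simp add: field_simps)
  qed
  then show ?thesis by (simp add: p_def q_def)
qed

lemma pd_kernel_abs_le:
  assumes "pd_kernel X N" "x \<in> X" "y \<in> X"
  shows "(N x y)\<^sup>2 \<le> N x x * N y y"
  using pd_kernel_Cauchy_Schwarz[OF assms(1,2), of 1 "\<lambda>_. y" "\<lambda>_. 1"] assms(3) by simp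

lemma sum_inner_sum:
  fixes n :: nat
  shows "inner (\<Sum>i<n. c i *\<^sub>R u i) (\<Sum>j<n. c j *\<^sub>R u j) = (\<Sum>i<n. \<Sum>j<n. c i * c j * inner (u i) (u j))"
  by (simp add: inner_sum_left inner_sum_right sum_distrib_left mult_ac inner_commute)

text \<open>
  Zorn's lemma is applied to partial realizations. Each new point adds at most one new orthonormal
  coordinate, so that the coordinates in use always lie in the closed span of the realized vectors.
\<close>

theorem pd_kernel_realization:
  fixes N :: "'i \<Rightarrow> 'i \<Rightarrow> real"
  assumes N: "pd_kernel X N"
  obtains \<phi> :: "'i \<Rightarrow> 'i l2" and I where
    "\<And>x y. x \<in> X \<Longrightarrow> y \<in> X \<Longrightarrow> inner (\<phi> x) (\<phi> y) = N x y"
    "\<phi> ` X \<subseteq> supp_l2 I" "unit_l2 ` I \<subseteq> closure (span (\<phi> ` X))"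
proof -
  \<comment> \<open>Coordinates are named by the points themselves, so a point not yet realized
    always has a coordinate of its own that is still free.\<close>
  define B :: "('i \<times> 'i l2) set \<Rightarrow> 'i set" where
    "B G = {i \<in> fst ` G. unit_l2 i \<in> closure (span (snd ` G))}" for G
  \<comment> \<open>Sets of pairs let Zorn's lemma run on inclusion. Single-valuedness is not
    imposed: the inner products force it, as \<open>uniq\<close> shows at the end.\<close>
  define P :: "('i \<times> 'i l2) set set" where
    "P = {G. fst ` G \<subseteq> X \<and> (\<forall>p\<in>G. \<forall>q\<in>G. inner (snd p) (snd q) = N (fst p) (fst q)) \<and>
           (\<forall>p\<in>G. snd p \<in> supp_l2 (B G))}"
  have B_mono: "B G \<subseteq> B H" if "G \<subseteq> H" for G H
    unfolding B_def using that closure_mono[OF span_mono[OF image_mono[OF that]]] by auto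
  have supp_mono: "supp_l2 I \<subseteq> supp_l2 I'" if "I \<subseteq> I'" for I I' :: "'i set"
    using that by (auto simp: supp_l2_def)
  have "\<exists>M\<in>P. \<forall>G\<in>P. M \<subseteq> G \<longrightarrow> G = M"
  proof (rule subset_Zorn')
    fix \<C> assume "subset.chain P \<C>"
    then have C: "\<C> \<subseteq> P" and lin: "\<And>G H. G \<in> \<C> \<Longrightarrow> H \<in> \<C> \<Longrightarrow> G \<subseteq> H \<or> H \<subseteq> G"
      by (auto simp: subset_chain_def)
    show "\<Union>\<C> \<in> P"
      unfolding P_def
    proof (intro CollectI conjI ballI)
      have "fst ` G \<subseteq> X" if "G \<in> \<C>" for G
        using subsetD[OF C that] by (simp add: P_def)
      then show "fst ` \<Union>\<C> \<subseteq> X" by fast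
    next
      fix p q assume "p \<in> \<Union>\<C>" "q \<in> \<Union>\<C>"
      then obtain G where "G \<in> \<C>" "p \<in> G" "q \<in> G" using lin by blast
      then show "inner (snd p) (snd q) = N (fst p) (fst q)"
        using subsetD[OF C \<open>G \<in> \<C>\<close>] by (simp add: P_def)
    next
      fix p assume "p \<in> \<Union>\<C>"
      then obtain G where "G \<in> \<C>" "p \<in> G" by blast
      then have "snd p \<in> supp_l2 (B G)"
        using subsetD[OF C \<open>G \<in> \<C>\<close>] by (simp add: P_def)
      then show "snd p \<in> supp_l2 (B (\<Union>\<C>))"
        using supp_mono[OF B_mono[of G "\<Union>\<C>"]] \<open>G \<in> \<C>\<close> by blast
    qed
  qed
  then obtain G where "G \<in> P" and max: "\<And>H. H \<in> P \<Longrightarrow> G \<subseteq> H \<Longrightarrow> H = G" by blast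
  from \<open>G \<in> P\<close> have G: "fst ` G \<subseteq> X" "\<And>p q. p \<in> G \<Longrightarrow> q \<in> G \<Longrightarrow> inner (snd p) (snd q) = N (fst p) (fst q)"
    "snd ` G \<subseteq> supp_l2 (B G)"
    unfolding P_def by blast+
  have span_supp: "closure (span (snd ` G)) \<subseteq> supp_l2 (B G)"
    by (intro closure_span_minimal subspace_supp_l2 closed_supp_l2 G)
  have "X \<subseteq> fst ` G"
  proof
    fix x assume "x \<in> X"
    show "x \<in> fst ` G"
    proof (rule ccontr)
      assume x: "x \<notin> fst ` G"
      have "0 \<le> N x x" using pd_kernel_diag_nonneg[OF N \<open>x \<in> X\<close>] .
      have bound: "(\<Sum>i<n. c i * N x (fst (p i)))\<^sup>2 \<le> N x x * (norm (\<Sum>i<n. c i *\<^sub>R snd (p i)))\<^sup>2"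
        if "\<And>i. i < n \<Longrightarrow> p i \<in> G" for n :: nat and p :: "nat \<Rightarrow> 'i \<times> 'i l2" and c
      proof -
        have "(norm (\<Sum>i<n. c i *\<^sub>R snd (p i)))\<^sup>2 = (\<Sum>i<n. \<Sum>j<n. c i * c j * N (fst (p i)) (fst (p j)))"
          unfolding power2_norm_eq_inner sum_inner_sum by (intro sum.cong refl) (simp add: G that)
        then show ?thesis
          using pd_kernel_Cauchy_Schwarz[OF N \<open>x \<in> X\<close>, of n "\<lambda>i. fst (p i)" c] G(1) that by auto
      qed
      obtain h where h: "h \<in> closure (span (snd ` G))" "(norm h)\<^sup>2 \<le> N x x"
        "\<And>p. p \<in> G \<Longrightarrow> inner h (snd p) = N x (fst p)"
        using Riesz_representation_family[where \<phi> = snd and L = "\<lambda>p. N x (fst p)", OF bound \<open>0 \<le> N x x\<close>]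
        by blast
      \<comment> \<open>As in Gram-Schmidt, \<open>h\<close> is the part of the new vector inside
        the closed span and \<open>r\<close> the length of the rest; the bound on
        \<open>norm h\<close> makes the root meaningful.\<close>
      define r where "r = sqrt (N x x - (norm h)\<^sup>2)"
      define u where "u = h + r *\<^sub>R unit_l2 x"
      have "x \<notin> B G" using x by (simp add: B_def)
      then have ortho: "coord v x = 0" if "v \<in> supp_l2 (B G)" for v
        using that by (simp add: supp_l2_def)
      have h_supp: "h \<in> supp_l2 (B G)" using h(1) span_supp by blast
      have u_inner: "inner u (snd p) = N x (fst p)" if "p \<in> G" for p
        using h(3)[OF that] ortho[of "snd p"] G(3) that
        by (auto simp: u_def inner_add_left inner_unit_left)
      have "inner u u = (norm h)\<^sup>2 + r\<^sup>2"
        using ortho[OF h_supp]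
        unfolding power2_norm_eq_inner
        by (simp add: u_def inner_add_left inner_add_right inner_unit_left inner_unit_right coord_unit
            power2_eq_square)
      then have u_self: "inner u u = N x x" using h(2) by (simp add: r_def)
      let ?H = "insert (x, u) G"
      have "snd ` ?H \<subseteq> supp_l2 (B ?H)"
      proof -
        have BH: "supp_l2 (B G) \<subseteq> supp_l2 (B ?H)" by (intro supp_mono B_mono) auto
        have "u \<in> supp_l2 (B ?H)"
        \<comment> \<open>The coordinate \<open>x\<close> is occupied only if \<open>r\<close> is
          nonzero, and then \<open>unit_l2 x\<close> is \<open>(u - h) / r\<close>, hence in the
          closed span.\<close>
        proof (cases "r = 0")
          case True
          then show ?thesis using BH h_supp by (auto simp: u_def)
        next
          case False
          have "h \<in> closure (span (snd ` ?H))"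
            using h(1) closure_mono[OF span_mono[of "snd ` G" "snd ` ?H"]] by auto
          moreover have "u \<in> closure (span (snd ` ?H))"
            by (rule subsetD[OF closure_subset]) (simp add: span_base)
          ultimately have "(1 / r) *\<^sub>R (u - h) \<in> closure (span (snd ` ?H))"
            by (intro subspace_mul subspace_diff subspace_closure_span)
          then have "x \<in> B ?H" using False by (simp add: u_def B_def)
          then have "unit_l2 x \<in> supp_l2 (B ?H)" by (auto simp: supp_l2_def coord_unit)
          then have "h + r *\<^sub>R unit_l2 x \<in> supp_l2 (B ?H)"
            using subsetD[OF BH h_supp] by (intro subspace_add subspace_mul subspace_supp_l2)
          then show ?thesis by (simp add: u_def)
        qed
        then show ?thesis using BH G(3) by auto
      qed
      moreover have "inner (snd p) (snd q) = N (fst p) (fst q)" if "p \<in> ?H" "q \<in> ?H" for p q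
      proof -
        have "inner (snd p) u = N (fst p) x" if "p \<in> G" for p
          using u_inner[OF that] pd_kernel_sym[OF N \<open>x \<in> X\<close>, of "fst p"] G(1) that
          by (simp add: inner_commute image_subset_iff)
        then show ?thesis
          using that by (elim insertE) (simp_all add: G(2) u_inner u_self)
      qed
      moreover have "fst ` ?H \<subseteq> X" using G(1) \<open>x \<in> X\<close> by simp
      ultimately have "?H \<in> P" unfolding P_def by blast
      then have "?H = G" using max by blast
      then show False using x by (metis fst_conv image_eqI insertI1)
    qed
  qed
  then have "\<forall>x\<in>X. \<exists>u. (x, u) \<in> G" by force
  then obtain \<phi> where \<phi>: "\<And>x. x \<in> X \<Longrightarrow> (x, \<phi> x) \<in> G" by metis
  have uniq: "snd p = \<phi> (fst p)" if "p \<in> G" for p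
  proof -
    have "fst p \<in> X" using that G(1) by auto
    have "inner (snd p - \<phi> (fst p)) (snd p - \<phi> (fst p)) = 0"
      using G(2)[OF that that] G(2)[OF that \<phi>[OF \<open>fst p \<in> X\<close>]]
        G(2)[OF \<phi>[OF \<open>fst p \<in> X\<close>] \<phi>[OF \<open>fst p \<in> X\<close>]]
      by (simp add: inner_diff_left inner_diff_right inner_commute)
    then show ?thesis by simp
  qed
  have "\<phi> ` X = snd ` G"
    using \<phi> uniq G(1) by (force simp: image_iff)
  then show thesis
    using that[of \<phi> "B G"] G \<phi> by (force simp: B_def)
qed

section \<open>Closure properties of positive definite kernels\<close>

lemma pd_kernel_cong:
  assumes "pd_kernel X N" and "\<And>x y. x \<in> X \<Longrightarrow> y \<in> X \<Longrightarrow> N x y = N' x y"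
  shows "pd_kernel X N'"
proof (rule pd_kernelI)
  fix x y assume "x \<in> X" "y \<in> X"
  then show "N' x y = N' y x" using pd_kernel_sym[OF assms(1)] assms(2) by metis
next
  fix n :: nat and x and c :: "nat \<Rightarrow> real" assume x: "\<And>i. i < n \<Longrightarrow> x i \<in> X"
  have "(\<Sum>i<n. \<Sum>j<n. c i * c j * N' (x i) (x j)) = (\<Sum>i<n. \<Sum>j<n. c i * c j * N (x i) (x j))"
    by (intro sum.cong refl) (simp add: assms(2) x)
  then show "0 \<le> (\<Sum>i<n. \<Sum>j<n. c i * c j * N' (x i) (x j))"
    using pd_kernel_sum_nonneg[OF assms(1) x] by simp
qed

lemma pd_kernel_inner: "pd_kernel X (\<lambda>x y. inner (\<phi> x) (\<phi> y))"
  by (rule pd_kernelI) (simp_all add: inner_commute flip: sum_inner_sum)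

text \<open>The map need only be meaningful where the weight is nonzero. This suits the projection
  to a copy, which makes sense only for points lying beyond that copy.\<close>

lemma pd_kernel_weighted_pullback:
  assumes N: "pd_kernel Y N" and f: "\<And>x. x \<in> X \<Longrightarrow> h x \<noteq> 0 \<Longrightarrow> f x \<in> Y"
  shows "pd_kernel X (\<lambda>x y. h x * h y * N (f x) (f y))"
proof (rule pd_kernelI)
  fix x y assume "x \<in> X" "y \<in> X"
  then show "h x * h y * N (f x) (f y) = h y * h x * N (f y) (f x)"
    using pd_kernel_sym[OF N f f, of x y] by auto
next
  fix n :: nat and x and c :: "nat \<Rightarrow> real" assume x: "\<And>i. i < n \<Longrightarrow> x i \<in> X"
  show "0 \<le> (\<Sum>i<n. \<Sum>j<n. c i * c j * (h (x i) * h (x j) * N (f (x i)) (f (x j))))"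
  proof (cases "Y = {}")
    case True
    then have "h (x i) = 0" if "i < n" for i using f x that by blast
    then show ?thesis by simp
  next
    case False
    then obtain y where "y \<in> Y" by blast
    \<comment> \<open>Meaningless values of \<open>f\<close> are replaced by an arbitrary point of
      \<open>Y\<close>; the weight 0 erases the difference.\<close>
    define g where "g i = (if h (x i) = 0 then y else f (x i))" for i
    have "0 \<le> (\<Sum>i<n. \<Sum>j<n. (c i * h (x i)) * (c j * h (x j)) * N (g i) (g j))"
      by (rule pd_kernel_sum_nonneg[OF N]) (simp add: g_def \<open>y \<in> Y\<close> f x)
    also have "\<dots> = (\<Sum>i<n. \<Sum>j<n. c i * c j * (h (x i) * h (x j) * N (f (x i)) (f (x j))))"
      by (intro sum.cong refl) (auto simp: g_def)
    finally show ?thesis .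
  qed
qed

lemma pd_kernel_weighted:
  "pd_kernel X N \<Longrightarrow> pd_kernel X (\<lambda>x y. h x * h y * N x y)"
  using pd_kernel_weighted_pullback[of X N X h "\<lambda>x. x"] by simp

lemma pd_kernel_rank_one: "pd_kernel X (\<lambda>x y. h x * h y :: real)"
  using pd_kernel_inner[of X h] by simp

lemma pd_kernel_add:
  assumes "pd_kernel X N" "pd_kernel X M"
  shows "pd_kernel X (\<lambda>x y. N x y + M x y)"
proof (rule pd_kernelI)
  fix n :: nat and x and c :: "nat \<Rightarrow> real" assume x: "\<And>i. i < n \<Longrightarrow> x i \<in> X"
  show "0 \<le> (\<Sum>i<n. \<Sum>j<n. c i * c j * (N (x i) (x j) + M (x i) (x j)))"
    using pd_kernel_sum_nonneg[where c = c, OF assms(1) x] pd_kernel_sum_nonneg[where c = c, OF assms(2) x]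
    by (simp add: distrib_left sum.distrib)
qed (simp add: pd_kernel_sym[OF assms(1)] pd_kernel_sym[OF assms(2)])

lemma pd_kernel_scale:
  assumes "pd_kernel X N" "0 \<le> a"
  shows "pd_kernel X (\<lambda>x y. a * N x y)"
  using pd_kernel_weighted[OF assms(1), of "\<lambda>_. sqrt a"] assms(2) by simp

lemma pd_kernel_zero: "pd_kernel X (\<lambda>_ _. 0)"
  by (rule pd_kernelI) simp_all

lemma pd_kernel_sum:
  assumes "finite S" "\<And>s. s \<in> S \<Longrightarrow> pd_kernel X (N s)"
  shows "pd_kernel X (\<lambda>x y. \<Sum>s\<in>S. N s x y)"
  using assms by (induction S rule: finite_induct) (simp_all add: pd_kernel_zero pd_kernel_add)

lemma pd_kernel_limit:
  assumes "\<And>s. pd_kernel X (N s)" "F \<noteq> bot"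
    and lim: "\<And>x y. x \<in> X \<Longrightarrow> y \<in> X \<Longrightarrow> ((\<lambda>s. N s x y) \<longlongrightarrow> N' x y) F"
  shows "pd_kernel X N'"
proof (rule pd_kernelI)
  fix x y assume "x \<in> X" "y \<in> X"
  then show "N' x y = N' y x"
    using tendsto_unique[OF \<open>F \<noteq> bot\<close> lim[of x y]] lim[of y x] pd_kernel_sym[OF assms(1)] by simp
next
  fix n :: nat and x and c :: "nat \<Rightarrow> real" assume x: "\<And>i. i < n \<Longrightarrow> x i \<in> X"
  show "0 \<le> (\<Sum>i<n. \<Sum>j<n. c i * c j * N' (x i) (x j))"
  proof (rule tendsto_lowerbound[OF _ _ \<open>F \<noteq> bot\<close>])
    show "((\<lambda>s. \<Sum>i<n. \<Sum>j<n. c i * c j * N s (x i) (x j)) \<longlongrightarrow>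
        (\<Sum>i<n. \<Sum>j<n. c i * c j * N' (x i) (x j))) F"
      by (intro tendsto_sum tendsto_mult tendsto_const lim x) auto
    show "\<forall>\<^sub>F s in F. 0 \<le> (\<Sum>i<n. \<Sum>j<n. c i * c j * N s (x i) (x j))"
      by (intro always_eventually allI pd_kernel_sum_nonneg[OF assms(1)] x)
  qed
qed

text \<open>Schur's product theorem: realize the first factor by vectors and expand it in coordinates.\<close>

lemma pd_kernel_mult:
  assumes "pd_kernel X N" "pd_kernel X M"
  shows "pd_kernel X (\<lambda>x y. N x y * M x y)"
proof -
  obtain \<phi> :: "'a \<Rightarrow> 'a l2" where \<phi>: "\<And>x y. x \<in> X \<Longrightarrow> y \<in> X \<Longrightarrow> inner (\<phi> x) (\<phi> y) = N x y"
    using pd_kernel_realization[OF assms(1)] by metis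
  show ?thesis
  proof (rule pd_kernel_limit)
    fix S :: "'a set"
    have "pd_kernel X (\<lambda>x y. \<Sum>i\<in>S. coord (\<phi> x) i * coord (\<phi> y) i * M x y)"
    proof (cases "finite S")
      case True
      then show ?thesis by (intro pd_kernel_sum pd_kernel_weighted assms(2))
    qed (simp add: pd_kernel_zero)
    then show "pd_kernel X (\<lambda>x y. (\<Sum>i\<in>S. coord (\<phi> x) i * coord (\<phi> y) i) * M x y)"
      by (simp add: sum_distrib_right)
  next
    fix x y assume "x \<in> X" "y \<in> X"
    have "((\<lambda>i. coord (\<phi> x) i * coord (\<phi> y) i) has_sum N x y) UNIV"
      using \<phi>[OF \<open>x \<in> X\<close> \<open>y \<in> X\<close>] summable_coord_mult[of "\<phi> x" "\<phi> y"]
      by (metis inner_l2_coord has_sum_infsum)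
    then show "((\<lambda>S. (\<Sum>i\<in>S. coord (\<phi> x) i * coord (\<phi> y) i) * M x y) \<longlongrightarrow> N x y * M x y)
        (finite_subsets_at_top UNIV)"
      unfolding has_sum_def by (intro tendsto_mult tendsto_const)
  qed simp
qed

lemma pd_kernel_power:
  "pd_kernel X N \<Longrightarrow> pd_kernel X (\<lambda>x y. N x y ^ k)"
  using pd_kernel_rank_one[of X "\<lambda>_. 1"]
  by (induction k) (simp_all add: pd_kernel_mult)

lemma pd_kernel_power_series:
  assumes "pd_kernel X N" "\<And>k. 0 \<le> a k"
    and "\<And>x y. x \<in> X \<Longrightarrow> y \<in> X \<Longrightarrow> (\<lambda>k. a k * N x y ^ k) sums S x y"
  shows "pd_kernel X S"
proof (rule pd_kernel_limit[OF _ trivial_limit_sequentially])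
  fix m
  show "pd_kernel X (\<lambda>x y. \<Sum>k<m. a k * N x y ^ k)"
    by (intro pd_kernel_sum pd_kernel_scale pd_kernel_power assms) auto
next
  fix x y assume "x \<in> X" "y \<in> X"
  then show "(\<lambda>m. \<Sum>k<m. a k * N x y ^ k) \<longlonglongrightarrow> S x y"
    using assms(3) by (simp add: sums_def)
qed

section \<open>Kernels of hyperbolic type\<close>

text \<open>This is the reverse Cauchy--Schwarz inequality of Lorentzian geometry.\<close>

lemma hyperbolic_kernel_row:
  fixes \<beta> :: "'a \<Rightarrow> 'a \<Rightarrow> real"
  assumes N: "pd_kernel X (\<lambda>x y. h x * h y - \<beta> x y)" and "e \<in> X" "\<beta> e e = 1"
  shows "pd_kernel X (\<lambda>x y. \<beta> x e * \<beta> y e - \<beta> x y)"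
proof (rule pd_kernelI)
  fix x y assume "x \<in> X" "y \<in> X"
  then show "\<beta> x e * \<beta> y e - \<beta> x y = \<beta> y e * \<beta> x e - \<beta> y x"
    using pd_kernel_sym[OF N] by (simp add: mult.commute)
next
  fix n :: nat and x and c :: "nat \<Rightarrow> real" assume x: "\<And>i. i < n \<Longrightarrow> x i \<in> X"
  define A where "A = (\<Sum>i<n. c i * h (x i))"
  define B where "B = (\<Sum>i<n. c i * \<beta> (x i) e)"
  define q where "q = (\<Sum>i<n. \<Sum>j<n. c i * c j * \<beta> (x i) (x j))"
  have expand: "(\<Sum>i<n. \<Sum>j<n. c i * c j * (f (x i) * f (x j) - \<beta> (x i) (x j))) = (\<Sum>i<n. c i * f (x i))\<^sup>2 - q"
    for f
    by (simp add: q_def power2_eq_square sum_product right_diff_distrib sum_subtractf mult_ac)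
  have "1 \<le> (h e)\<^sup>2"
    using pd_kernel_diag_nonneg[OF N \<open>e \<in> X\<close>] assms(3) by (simp add: power2_eq_square)
  then have "h e \<noteq> 0" by auto
  \<comment> \<open>The weight of \<open>e\<close> that cancels the \<open>h\<close>-part of the
    combination. Positivity then reads \<open>- (q + 2 * s * B + s\<^sup>2) \<ge> 0\<close>, and
    completing the square gives the claim.\<close>
  define s where "s = - A / h e"
  have row: "(\<Sum>i<n. c i * (h e * h (x i) - \<beta> e (x i))) = h e * A - B"
  proof -
    have "\<beta> e (x i) = \<beta> (x i) e" if "i < n" for i
      using pd_kernel_sym[OF N x[OF that] \<open>e \<in> X\<close>] by (simp add: mult.commute)
    then show ?thesis
      by (simp add: A_def B_def right_diff_distrib sum_subtractf sum_distrib_left mult_ac)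
  qed
  let ?N = "\<lambda>x y. h x * h y - \<beta> x y"
  have "0 \<le> (\<Sum>i<Suc n. \<Sum>j<Suc n. (c(n := s)) i * (c(n := s)) j * ?N ((x(n := e)) i) ((x(n := e)) j))"
    by (rule pd_kernel_sum_nonneg[OF N]) (use \<open>e \<in> X\<close> x in \<open>auto simp: less_Suc_eq\<close>)
  also have "\<dots> = (\<Sum>i<n. \<Sum>j<n. c i * c j * ?N (x i) (x j)) + 2 * s * (\<Sum>i<n. c i * ?N e (x i)) + s\<^sup>2 * ?N e e"
    by (rule quadratic_form_Suc) (rule pd_kernel_sym[OF N x \<open>e \<in> X\<close>])
  also have "\<dots> = A\<^sup>2 - q + 2 * s * (h e * A - B) + s\<^sup>2 * ((h e)\<^sup>2 - 1)"
    unfolding expand row by (simp add: A_def assms(3) power2_eq_square)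
  also have "\<dots> = B\<^sup>2 - q - (s + B)\<^sup>2"
    using \<open>h e \<noteq> 0\<close> by (simp add: s_def field_simps power2_eq_square)
  finally have "q \<le> B\<^sup>2" using zero_le_power2[of "s + B"] by linarith
  then show "0 \<le> (\<Sum>i<n. \<Sum>j<n. c i * c j * (\<beta> (x i) e * \<beta> (x j) e - \<beta> (x i) (x j)))"
    using expand[of "\<lambda>y. \<beta> y e"] by (simp add: B_def)
qed

text \<open>\<open>M\<close> is the Gram kernel of the points in the Klein ball model:
  \<open>\<beta> x y\<close> is \<open>\<beta> x e * \<beta> y e * (1 - M x y)\<close>. Positivity
  of \<open>\<beta>\<close> puts the diagonal below 1, Cauchy-Schwarz does the rest, and so power
  series in \<open>M\<close> converge.\<close>

lemma hyperbolic_kernel_normalized: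
  fixes \<beta> :: "'a \<Rightarrow> 'a \<Rightarrow> real"
  assumes N: "pd_kernel X (\<lambda>x y. \<beta> x e * \<beta> y e - \<beta> x y)"
    and pos: "\<And>x y. x \<in> X \<Longrightarrow> y \<in> X \<Longrightarrow> 0 < \<beta> x y" and "e \<in> X"
  defines "M \<equiv> \<lambda>x y. 1 - \<beta> x y / (\<beta> x e * \<beta> y e)"
  shows "pd_kernel X M" "\<And>x y. x \<in> X \<Longrightarrow> y \<in> X \<Longrightarrow> \<bar>M x y\<bar> < 1"
proof -
  show M: "pd_kernel X M"
  proof (rule pd_kernel_cong)
    show "pd_kernel X (\<lambda>x y. 1 / \<beta> x e * (1 / \<beta> y e) * (\<beta> x e * \<beta> y e - \<beta> x y))"
      by (rule pd_kernel_weighted[OF N])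
    fix x y assume "x \<in> X" "y \<in> X"
    then show "1 / \<beta> x e * (1 / \<beta> y e) * (\<beta> x e * \<beta> y e - \<beta> x y) = M x y"
      using pos[OF \<open>x \<in> X\<close> \<open>e \<in> X\<close>] pos[OF \<open>y \<in> X\<close> \<open>e \<in> X\<close>] by (simp add: M_def field_simps)
  qed
  have diag: "0 \<le> M x x" "M x x < 1" if "x \<in> X" for x
    using pd_kernel_diag_nonneg[OF M that] pos[OF that \<open>e \<in> X\<close>] pos[OF that that]
    by (simp_all add: M_def)
  fix x y assume "x \<in> X" "y \<in> X"
  then have "(M x y)\<^sup>2 \<le> M x x * M y y" by (rule pd_kernel_abs_le[OF M])
  also have "\<dots> < 1"
    using diag[OF \<open>x \<in> X\<close>] diag[OF \<open>y \<in> X\<close>] mult_strict_mono'[of "M x x" 1 "M y y" 1] by simp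
  finally show "\<bar>M x y\<bar> < 1" by (simp add: abs_square_less_1)
qed

text \<open>Up to a positive factor this is the product of -t, 1 - t, 2 - t and so on; for t \<le> 1
  only the first factor can be negative.\<close>

lemma gbinomial_alternating_nonpos:
  fixes t :: real
  assumes "0 \<le> t" "t \<le> 1" "0 < k"
  shows "(t gchoose k) * (- 1) ^ k \<le> 0"
proof -
  obtain m where k: "k = Suc m" using \<open>0 < k\<close> by (cases k) auto
  have "0 \<le> pochhammer (1 - t) m"
    unfolding pochhammer_prod using assms by (intro prod_nonneg) auto
  then have "pochhammer (- t) k \<le> 0"
    using \<open>0 \<le> t\<close> by (simp add: k pochhammer_rec mult_nonneg_nonneg)
  then show ?thesis
    by (cases "even k") (simp_all add: gbinomial_pochhammer divide_nonpos_pos)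
qed

text \<open>
  For \<open>0 < t \<le> 1\<close> all coefficients of the binomial series of \<open>1 - (1 - M)\<^sup>t\<close> are nonnegative.
\<close>

lemma hyperbolic_kernel_powr:
  fixes \<beta> :: "'a \<Rightarrow> 'a \<Rightarrow> real"
  assumes N: "pd_kernel X (\<lambda>x y. \<beta> x e * \<beta> y e - \<beta> x y)"
    and pos: "\<And>x y. x \<in> X \<Longrightarrow> y \<in> X \<Longrightarrow> 0 < \<beta> x y" and "e \<in> X" and t: "0 < t" "t \<le> 1"
  shows "pd_kernel X (\<lambda>x y. \<beta> x e powr t * \<beta> y e powr t - \<beta> x y powr t)"
proof -
  define M where "M x y = 1 - \<beta> x y / (\<beta> x e * \<beta> y e)" for x y
  note M = hyperbolic_kernel_normalized[OF N pos \<open>e \<in> X\<close>, folded M_def]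
  define a where "a k = (if k = 0 then 0 else - ((t gchoose k) * (- 1) ^ k))" for k :: nat
  have "pd_kernel X (\<lambda>x y. 1 - (1 - M x y) powr t)"
  proof (rule pd_kernel_power_series[OF M(1)])
    show "0 \<le> a k" for k using gbinomial_alternating_nonpos[of t k] t by (simp add: a_def)
    fix x y assume "x \<in> X" "y \<in> X"
    then have "(\<lambda>k. (t gchoose k) * (- M x y) ^ k) sums (1 + - M x y) powr t"
      by (intro gen_binomial_real) (simp add: M(2))
    then have "(\<lambda>k. (if k = 0 then 1 else 0) - (t gchoose k) * (- M x y) ^ k) sums (1 - (1 + - M x y) powr t)"
      using sums_If_finite_set[of "{0}" "\<lambda>_. 1 :: real"] by (intro sums_diff) auto
    moreover have "(if k = 0 then 1 else 0) - (t gchoose k) * (- M x y) ^ k = a k * M x y ^ k" for k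
      using power_minus[of "M x y" k] by (simp add: a_def)
    ultimately show "(\<lambda>k. a k * M x y ^ k) sums (1 - (1 - M x y) powr t)" by simp
  qed
  from pd_kernel_weighted[OF this, of "\<lambda>x. \<beta> x e powr t"] show ?thesis
  proof (rule pd_kernel_cong)
    fix x y assume "x \<in> X" "y \<in> X"
    then have "0 < \<beta> x e" "0 < \<beta> y e" "0 < \<beta> x y" using pos \<open>e \<in> X\<close> by auto
    then show "\<beta> x e powr t * \<beta> y e powr t * (1 - (1 - M x y) powr t) =
        \<beta> x e powr t * \<beta> y e powr t - \<beta> x y powr t"
      by (simp add: M_def powr_divide powr_mult field_simps)
  qed
qed

text \<open>Geometric series in the normalized kernel. Applied to cosh d, it makes 1 / cosh d
  available as the input of \<open>exp_arcosh_iter\<close>.\<close>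

lemma hyperbolic_kernel_inverse:
  fixes \<beta> :: "'a \<Rightarrow> 'a \<Rightarrow> real"
  assumes N: "pd_kernel X (\<lambda>x y. \<beta> x e * \<beta> y e - \<beta> x y)"
    and pos: "\<And>x y. x \<in> X \<Longrightarrow> y \<in> X \<Longrightarrow> 0 < \<beta> x y" and "e \<in> X"
  shows "pd_kernel X (\<lambda>x y. 1 / \<beta> x y)"
proof -
  define M where "M x y = 1 - \<beta> x y / (\<beta> x e * \<beta> y e)" for x y
  note M = hyperbolic_kernel_normalized[OF N pos \<open>e \<in> X\<close>, folded M_def]
  have "pd_kernel X (\<lambda>x y. 1 / (1 - M x y))"
    by (rule pd_kernel_power_series[OF M(1), of "\<lambda>_. 1"]) (simp_all add: geometric_sums M(2))
  from pd_kernel_weighted[OF this, of "\<lambda>x. 1 / \<beta> x e"] show ?thesis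
  proof (rule pd_kernel_cong)
    fix x y assume "x \<in> X" "y \<in> X"
    then have "0 < \<beta> x e" "0 < \<beta> y e" "0 < \<beta> x y" using pos \<open>e \<in> X\<close> by auto
    then show "1 / \<beta> x e * (1 / \<beta> y e) * (1 / (1 - M x y)) = 1 / \<beta> x y"
      by (simp add: M_def)
  qed
qed

section \<open>From the hyperbolic cosine to the exponential\<close>

lemma exp_arcosh: "1 \<le> z \<Longrightarrow> exp (arcosh z) = 2 * z - exp (- arcosh z)" for z :: real
  using cosh_arcosh_real[of z] by (simp add: cosh_def)

text \<open>With \<open>w = 1 / z\<close>, the number \<open>exp (- arcosh z)\<close> is the smallest root of \<open>q = w (1 + q\<^sup>2) / 2\<close>.\<close>

primrec exp_arcosh_iter :: "real \<Rightarrow> nat \<Rightarrow> real" where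
  "exp_arcosh_iter w 0 = 0"
| "exp_arcosh_iter w (Suc n) = w * (1 + (exp_arcosh_iter w n)\<^sup>2) / 2"

text \<open>The iteration is monotone and starts at 0, below the fixed point \<open>r\<close>; so it
  increases to a fixed point that is at most \<open>r\<close>.\<close>

lemma exp_arcosh_iter_tendsto:
  assumes "1 \<le> z"
  shows "exp_arcosh_iter (1 / z) \<longlonglongrightarrow> exp (- arcosh z)"
proof -
  define r where "r = exp (- arcosh z)"
  have r: "0 < r" "r \<le> 1" using assms by (simp_all add: r_def)
  have z: "2 * z = 1 / r + r"
    using exp_arcosh[OF assms] by (simp add: r_def exp_minus field_simps)
  have root: "1 / z * (1 + r\<^sup>2) / 2 = r"
    using z r assms by (simp add: field_simps power2_eq_square)
  let ?q = "exp_arcosh_iter (1 / z)"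
  have q: "0 \<le> ?q n \<and> ?q n \<le> r \<and> ?q n \<le> ?q (Suc n)" for n
  proof (induction n)
    case 0
    then show ?case using r assms by simp
  next
    case (Suc n)
    have mono: "1 / z * (1 + a\<^sup>2) / 2 \<le> 1 / z * (1 + b\<^sup>2) / 2" if "0 \<le> a" "a \<le> b" for a b
      using power_mono[OF that(2,1), of 2] assms by (simp add: divide_right_mono)
    have "?q (Suc n) \<le> ?q (Suc (Suc n))"
      using mono[of "?q n" "?q (Suc n)"] Suc by simp
    moreover have "?q (Suc n) \<le> r" using mono[of "?q n" r] Suc root by simp
    ultimately show ?case using Suc by linarith
  qed
  then obtain l where l: "?q \<longlonglongrightarrow> l"
    using incseq_convergent[of ?q r] incseq_SucI[of ?q] by blast
  have "l \<le> r" using l q by (intro LIMSEQ_le_const2) auto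
  have "(\<lambda>n. 1 / z * (1 + (?q n)\<^sup>2) / 2) \<longlonglongrightarrow> 1 / z * (1 + l\<^sup>2) / 2"
    by (intro tendsto_intros l) simp
  moreover have "(\<lambda>n. 1 / z * (1 + (?q n)\<^sup>2) / 2) \<longlonglongrightarrow> l"
    using LIMSEQ_Suc[OF l] by simp
  ultimately have "1 / z * (1 + l\<^sup>2) / 2 = l" by (rule LIMSEQ_unique)
  then have "r * (1 + l\<^sup>2) = (2 * z * r) * l" using assms by (simp add: field_simps)
  also have "2 * z * r = 1 + r\<^sup>2" using r z by (simp add: field_simps power2_eq_square)
  \<comment> \<open>The two fixed points are \<open>r\<close> and \<open>1 / r\<close>; the second
    exceeds \<open>r\<close> unless both are 1.\<close>
  finally have "(l - r) * (1 - r * l) = 0"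
    by (simp add: algebra_simps power2_eq_square)
  moreover have "r * l = 1 \<Longrightarrow> l = r"
    using r \<open>l \<le> r\<close> by (smt (verit) mult_le_cancel_left1 mult_left_le)
  ultimately have "l = r" by auto
  then show ?thesis using l by (simp add: r_def)
qed

text \<open>Every iterate is a polynomial in 1 / z with nonnegative coefficients, so positive
  definiteness is inherited at each step and by the limit.\<close>

lemma pd_kernel_exp_minus_arcosh:
  assumes "pd_kernel X (\<lambda>x y. 1 / z x y)" and "\<And>x y. x \<in> X \<Longrightarrow> y \<in> X \<Longrightarrow> 1 \<le> z x y"
  shows "pd_kernel X (\<lambda>x y. exp (- arcosh (z x y)))"
proof (rule pd_kernel_limit[where N = "\<lambda>n x y. exp_arcosh_iter (1 / z x y) n", OF _ trivial_limit_sequentially])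
  fix n
  show "pd_kernel X (\<lambda>x y. exp_arcosh_iter (1 / z x y) n)"
  proof (induction n)
    case 0
    then show ?case by (simp add: pd_kernel_zero)
  next
    case (Suc n)
    \<comment> \<open>The constant 1 is written \<open>1 * 1\<close> to match
      \<open>pd_kernel_rank_one\<close>.\<close>
    have "pd_kernel X (\<lambda>x y. 1 / 2 * (1 / z x y * (1 * 1 + (exp_arcosh_iter (1 / z x y) n)\<^sup>2)))"
      by (intro pd_kernel_scale pd_kernel_mult pd_kernel_add pd_kernel_power assms(1) Suc
          pd_kernel_rank_one) simp
    then show ?case by (simp add: mult.commute)
  qed
qed (simp add: exp_arcosh_iter_tendsto assms(2))

text \<open>\<open>h\<close> is left free because it will be the time coordinate of the model, whose
  origin need not be \<open>e\<close>; \<open>hyperbolic_kernel_row\<close> moves the base point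
  afterwards.\<close>

theorem hyperbolic_kernel_exp_arcosh:
  fixes z :: "'a \<Rightarrow> 'a \<Rightarrow> real"
  assumes N: "pd_kernel X (\<lambda>x y. h x * h y - z x y)"
    and z: "\<And>x y. x \<in> X \<Longrightarrow> y \<in> X \<Longrightarrow> 1 \<le> z x y" and "e \<in> X" "z e e = 1" and t: "0 < t" "t \<le> 1"
  shows "pd_kernel X (\<lambda>x y. exp (t * arcosh (z x e)) * exp (t * arcosh (z y e)) - exp (t * arcosh (z x y)))"
proof -
  have "0 < z x y" if "x \<in> X" "y \<in> X" for x y using z[OF that] by linarith
  then have "pd_kernel X (\<lambda>x y. 1 / z x y)"
    using hyperbolic_kernel_inverse[OF hyperbolic_kernel_row[OF N \<open>e \<in> X\<close> \<open>z e e = 1\<close>]] \<open>e \<in> X\<close> by blast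
  then have "pd_kernel X (\<lambda>x y. 2 * (h x * h y - z x y) + exp (- arcosh (z x y)))"
    by (intro pd_kernel_add pd_kernel_scale[OF N] pd_kernel_exp_minus_arcosh z) auto
  \<comment> \<open>The factor 2 in front of cosh is absorbed into \<open>h\<close>, which restores
    the shape that \<open>hyperbolic_kernel_row\<close> expects.\<close>
  then have "pd_kernel X (\<lambda>x y. (sqrt 2 * h x) * (sqrt 2 * h y) - exp (arcosh (z x y)))"
    by (rule pd_kernel_cong) (simp add: exp_arcosh z algebra_simps)
  then have "pd_kernel X (\<lambda>x y. exp (arcosh (z x e)) * exp (arcosh (z y e)) - exp (arcosh (z x y)))"
    by (rule hyperbolic_kernel_row[OF _ \<open>e \<in> X\<close>]) (simp add: \<open>z e e = 1\<close>)
  from hyperbolic_kernel_powr[OF this _ \<open>e \<in> X\<close> t] show ?thesis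
    by (simp add: powr_def)
qed

section \<open>Exponential kernels on real hyperbolic spaces\<close>

definition lor :: "real \<times> 'k l2 \<Rightarrow> real \<times> 'k l2 \<Rightarrow> real" where
  "lor Y Z = fst Y * fst Z - inner (snd Y) (snd Z)"

definition lor_class :: "real \<times> 'k l2 \<Rightarrow> 'k hpoint" where
  "lor_class Y = proj_class (fst Y, coord (snd Y))"

lemma lorentz_coord: "lorentz (a, coord u) (c, coord v) = lor (a, u) (c, v)"
  by (simp add: lorentz_def lor_def inner_l2_coord)

lemma lor_scaleR [simp]: "lor (c *\<^sub>R Y) Z = c * lor Y Z" "lor Y (c *\<^sub>R Z) = c * lor Y Z"
  by (simp_all add: lor_def algebra_simps)

lemma lor_commute: "lor Y Z = lor Z Y"
  by (simp add: lor_def inner_commute mult.commute)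

lemma mem_lor_class: "X \<in> lor_class Y \<longleftrightarrow> (\<exists>c. c \<noteq> 0 \<and> X = (fst (c *\<^sub>R Y), coord (snd (c *\<^sub>R Y))))"
  by (auto simp: lor_class_def proj_class_def fun_eq_iff)

lemma lor_class_eqD:
  assumes "lor_class Y = lor_class Z"
  obtains c where "c \<noteq> 0" "Y = c *\<^sub>R Z"
proof -
  have "(fst Y, coord (snd Y)) \<in> lor_class Y"
    using mem_lor_class[of _ Y] by (metis scaleR_one zero_neq_one)
  then obtain c where "c \<noteq> 0" "(fst Y, coord (snd Y)) = (fst (c *\<^sub>R Z), coord (snd (c *\<^sub>R Z)))"
    using assms mem_lor_class by metis
  then show thesis using that by (simp add: coord_inject prod_eq_iff)
qed

lemma lor_class_scaleR: "c \<noteq> 0 \<Longrightarrow> lor_class (c *\<^sub>R Y) = lor_class Y"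
proof (rule Set.set_eqI)
  fix X assume "c \<noteq> 0"
  have "\<exists>d. d \<noteq> 0 \<and> X = (fst (d *\<^sub>R Y), coord (snd (d *\<^sub>R Y)))"
    if "e \<noteq> 0" "X = (fst (e *\<^sub>R c *\<^sub>R Y), coord (snd (e *\<^sub>R c *\<^sub>R Y)))" for e
    using that \<open>c \<noteq> 0\<close> by (intro exI[of _ "e * c"]) simp
  moreover have "\<exists>d. d \<noteq> 0 \<and> X = (fst (d *\<^sub>R c *\<^sub>R Y), coord (snd (d *\<^sub>R c *\<^sub>R Y)))"
    if "e \<noteq> 0" "X = (fst (e *\<^sub>R Y), coord (snd (e *\<^sub>R Y)))" for e
    using that \<open>c \<noteq> 0\<close> by (intro exI[of _ "e / c"]) simp
  ultimately show "X \<in> lor_class (c *\<^sub>R Y) \<longleftrightarrow> X \<in> lor_class Y"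
    unfolding mem_lor_class by blast
qed

text \<open>The representatives picked by \<open>SOME\<close> are unknown multiples of
  \<open>Y\<close> and \<open>Z\<close>; numerator and denominator scale by the same factor.\<close>

lemma hyp_dist_lor_class:
  assumes "0 < lor Y Y" "0 < lor Z Z"
  shows "hyp_dist (lor_class Y) (lor_class Z) = arcosh (\<bar>lor Y Z\<bar> / sqrt (lor Y Y * lor Z Z))"
proof -
  have some: "\<exists>c. c \<noteq> 0 \<and> (SOME X. X \<in> lor_class Y) = (fst (c *\<^sub>R Y), coord (snd (c *\<^sub>R Y)))" for Y :: "real \<times> 'a l2"
    using someI_ex[of "\<lambda>X. X \<in> lor_class Y"] mem_lor_class[of _ Y] by (metis zero_neq_one)
  obtain c where c: "c \<noteq> 0" "(SOME X. X \<in> lor_class Y) = (fst (c *\<^sub>R Y), coord (snd (c *\<^sub>R Y)))"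
    using some by blast
  obtain d where d: "d \<noteq> 0" "(SOME X. X \<in> lor_class Z) = (fst (d *\<^sub>R Z), coord (snd (d *\<^sub>R Z)))"
    using some by blast
  have eq: "c * (c * lor Y Y) * (d * (d * lor Z Z)) = (c * d)\<^sup>2 * (lor Y Y * lor Z Z)"
    by (simp add: power2_eq_square)
  have "sqrt (c * (c * lor Y Y) * (d * (d * lor Z Z))) = \<bar>c * d\<bar> * sqrt (lor Y Y * lor Z Z)"
    unfolding eq by (simp only: real_sqrt_mult real_sqrt_abs)
  then have "\<bar>d * (c * lor Y Z)\<bar> / sqrt (c * (c * lor Y Y) * (d * (d * lor Z Z))) =
      \<bar>lor Y Z\<bar> / sqrt (lor Y Y * lor Z Z)"
    using c d by (simp add: abs_mult)
  then show ?thesis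
    unfolding hyp_dist_def Let_def c(2) d(2) lorentz_coord prod.collapse by simp
qed

lemma hyp_space_lor_class:
  "hyp_space K = lor_class ` {Y. snd Y \<in> supp_l2 K \<and> 0 < lor Y Y}"
proof (intro Set.set_eqI iffI)
  fix P :: "'a hpoint" assume "P \<in> hyp_space K"
  then obtain X where X: "P = proj_class X" "snd X \<in> ell2 K" "0 < lorentz X X"
    by (auto simp: hyp_space_def)
  obtain u where "u \<in> supp_l2 K" "snd X = coord u" using X(2) by (rule ell2_coordE)
  then have "P = lor_class (fst X, u)" "0 < lor (fst X, u) (fst X, u)"
    using X lorentz_coord[of "fst X" u "fst X" u] by (simp_all add: lor_class_def flip: \<open>snd X = coord u\<close>)
  then show "P \<in> lor_class ` {Y. snd Y \<in> supp_l2 K \<and> 0 < lor Y Y}"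
    using \<open>u \<in> supp_l2 K\<close> by (intro image_eqI[of _ _ "(fst X, u)"]) auto
next
  fix P :: "'a hpoint" assume "P \<in> lor_class ` {Y. snd Y \<in> supp_l2 K \<and> 0 < lor Y Y}"
  then obtain Y where "P = lor_class Y" "snd Y \<in> supp_l2 K" "0 < lor Y Y" by blast
  then show "P \<in> hyp_space K"
    using lorentz_coord[of "fst Y" "snd Y" "fst Y" "snd Y"]
    by (auto simp: hyp_space_def lor_class_def coord_ell2)
qed

text \<open>Representatives on the upper sheet of the hyperboloid, where the distance formula loses
  both the absolute value and the root.\<close>

lemma hyp_space_normalizedE:
  assumes "P \<in> hyp_space K"
  obtains Y where "P = lor_class Y" "snd Y \<in> supp_l2 K" "lor Y Y = 1" "0 < fst Y"
proof -
  from assms obtain Z where Z: "P = lor_class Z" "snd Z \<in> supp_l2 K" "0 < lor Z Z"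
    by (auto simp: hyp_space_lor_class)
  have "fst Z \<noteq> 0"
  proof
    assume "fst Z = 0"
    then show False using Z(3) inner_ge_zero[of "snd Z"] by (simp add: lor_def)
  qed
  define c where "c = sgn (fst Z) / sqrt (lor Z Z)"
  have "c \<noteq> 0" using Z(3) \<open>fst Z \<noteq> 0\<close> by (simp add: c_def sgn_zero_iff)
  show thesis
  proof
    show "P = lor_class (c *\<^sub>R Z)" using Z(1) \<open>c \<noteq> 0\<close> by (simp add: lor_class_scaleR)
    show "snd (c *\<^sub>R Z) \<in> supp_l2 K" using Z(2) by (simp add: supp_l2_def)
    have "c * c * lor Z Z = 1"
      using Z(3) \<open>fst Z \<noteq> 0\<close> by (simp add: c_def sgn_real_def)
    then show "lor (c *\<^sub>R Z) (c *\<^sub>R Z) = 1" by (simp add: mult.assoc)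
    show "0 < fst (c *\<^sub>R Z)"
      using Z(3) \<open>fst Z \<noteq> 0\<close> by (simp add: c_def sgn_real_def)
  qed
qed

lemma lor_ge_1:
  assumes "lor Y Y = 1" "lor Z Z = 1" "0 < fst Y" "0 < fst Z"
  shows "1 \<le> lor Y Z" and "lor Y Z = 1 \<Longrightarrow> Y = Z"
proof -
  define a c p where "a = fst Y" and "c = fst Z" and "p = inner (snd Y) (snd Z)"
  have pos: "0 < a" "0 < c" using assms by (simp_all add: a_def c_def)
  have Y: "inner (snd Y) (snd Y) = a\<^sup>2 - 1" and Z: "inner (snd Z) (snd Z) = c\<^sup>2 - 1"
    using assms by (simp_all add: lor_def a_def c_def power2_eq_square)
  have CS: "p\<^sup>2 \<le> (a\<^sup>2 - 1) * (c\<^sup>2 - 1)"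
    using Cauchy_Schwarz_ineq[of "snd Y" "snd Z"] by (simp add: p_def Y Z)
  have "1 \<le> a\<^sup>2" "1 \<le> c\<^sup>2" using inner_ge_zero[of "snd Y"] inner_ge_zero[of "snd Z"] Y Z by linarith+
  then have "1 \<le> a" "1 \<le> c" using pos by (simp_all flip: abs_le_square_iff[of 1, simplified])
  then have "0 \<le> a * c - 1" using mult_mono[of 1 a 1 c] by simp
  \<comment> \<open>The surplus \<open>(a - c)\<^sup>2\<close> gives the inequality and also decides
    equality: \<open>p = a * c - 1\<close> forces \<open>a = c\<close>.\<close>
  have key: "(a\<^sup>2 - 1) * (c\<^sup>2 - 1) = (a * c - 1)\<^sup>2 - (a - c)\<^sup>2"
    by (simp add: algebra_simps power2_eq_square)
  have "p\<^sup>2 \<le> (a * c - 1)\<^sup>2" using CS key zero_le_power2[of "a - c"] by linarith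
  then have "p \<le> a * c - 1" using \<open>0 \<le> a * c - 1\<close> by (rule power2_le_imp_le)
  then show "1 \<le> lor Y Z" by (simp add: lor_def a_def c_def p_def)
  assume "lor Y Z = 1"
  then have p: "p = a * c - 1" by (simp add: lor_def a_def c_def p_def)
  then have "(a - c)\<^sup>2 \<le> 0" using CS key by simp
  then have "a = c" by simp
  have "inner (snd Y - snd Z) (snd Y - snd Z) = (a\<^sup>2 - 1) + (c\<^sup>2 - 1) - 2 * p"
    by (simp add: p_def inner_diff_left inner_diff_right inner_commute flip: Y Z)
  also have "\<dots> = 0" by (simp add: p \<open>a = c\<close> power2_eq_square)
  finally show "Y = Z" using \<open>a = c\<close> by (simp add: prod_eq_iff a_def c_def)
qed

lemma hyp_dist_normalized:
  assumes "lor Y Y = 1" "lor Z Z = 1" "0 < fst Y" "0 < fst Z"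
  shows "hyp_dist (lor_class Y) (lor_class Z) = arcosh (lor Y Z)"
  using assms lor_ge_1(1)[OF assms] by (simp add: hyp_dist_lor_class)

lemma hyp_dist_nonneg:
  assumes "P \<in> hyp_space K" "Q \<in> hyp_space K"
  shows "0 \<le> hyp_dist P Q"
  using assms by (elim hyp_space_normalizedE) (simp add: hyp_dist_normalized lor_ge_1(1))

lemma hyp_dist_self: "P \<in> hyp_space K \<Longrightarrow> hyp_dist P P = 0"
  by (elim hyp_space_normalizedE) (simp add: hyp_dist_normalized)

lemma hyp_dist_commute:
  assumes "P \<in> hyp_space K" "Q \<in> hyp_space K"
  shows "hyp_dist P Q = hyp_dist Q P"
  using assms by (elim hyp_space_normalizedE) (simp add: hyp_dist_normalized lor_commute)

lemma hyp_dist_eq_0: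
  assumes "P \<in> hyp_space K" "Q \<in> hyp_space K" "hyp_dist P Q = 0"
  shows "P = Q"
proof -
  obtain Y where Y: "P = lor_class Y" "lor Y Y = 1" "0 < fst Y" using assms(1) by (rule hyp_space_normalizedE)
  obtain Z where Z: "Q = lor_class Z" "lor Z Z = 1" "0 < fst Z" using assms(2) by (rule hyp_space_normalizedE)
  have "lor Y Z = 1"
    using assms(3) lor_ge_1(1)[of Y Z] Y Z by (simp add: hyp_dist_normalized)
  then show ?thesis using lor_ge_1(2) Y Z by metis
qed

theorem hyp_space_exp_kernel:
  assumes "E \<in> hyp_space K" "0 < t" "t \<le> 1"
  shows "pd_kernel (hyp_space K)
    (\<lambda>P Q. exp (t * hyp_dist P E) * exp (t * hyp_dist Q E) - exp (t * hyp_dist P Q))"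
proof -
  have "\<forall>P\<in>hyp_space K. \<exists>Y. P = lor_class Y \<and> lor Y Y = 1 \<and> 0 < fst Y"
    by (metis hyp_space_normalizedE)
  then obtain n where n: "\<And>P. P \<in> hyp_space K \<Longrightarrow> P = lor_class (n P) \<and> lor (n P) (n P) = 1 \<and> 0 < fst (n P)"
    by metis
  have ge_1: "1 \<le> lor (n P) (n Q)" if "P \<in> hyp_space K" "Q \<in> hyp_space K" for P Q
    using n[OF that(1)] n[OF that(2)] lor_ge_1(1)[of "n P" "n Q"] by blast
  \<comment> \<open>The product of the time coordinates minus \<open>lor\<close> is the inner
    product of the space parts.\<close>
  have "pd_kernel (hyp_space K) (\<lambda>P Q. fst (n P) * fst (n Q) - lor (n P) (n Q))"
    by (rule pd_kernel_cong[OF pd_kernel_inner]) (simp add: lor_def)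
  then have "pd_kernel (hyp_space K) (\<lambda>P Q. exp (t * arcosh (lor (n P) (n E))) * exp (t * arcosh (lor (n Q) (n E)))
      - exp (t * arcosh (lor (n P) (n Q))))"
    by (rule hyperbolic_kernel_exp_arcosh) (use assms n in \<open>simp_all add: ge_1\<close>)
  then show ?thesis
  proof (rule pd_kernel_cong)
    have d: "arcosh (lor (n P) (n Q)) = hyp_dist P Q" if "P \<in> hyp_space K" "Q \<in> hyp_space K" for P Q
      using n[OF that(1)] n[OF that(2)] hyp_dist_normalized[of "n P" "n Q"] by simp
    fix P Q assume "P \<in> hyp_space K" "Q \<in> hyp_space K"
    then show "exp (t * arcosh (lor (n P) (n E))) * exp (t * arcosh (lor (n Q) (n E)))
      - exp (t * arcosh (lor (n P) (n Q))) = exp (t * hyp_dist P E) * exp (t * hyp_dist Q E) - exp (t * hyp_dist P Q)"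
      by (simp add: d assms(1))
  qed
qed

section \<open>Free products\<close>

text \<open>For finitely many points only finitely many copies matter, so the decomposition of the
  free product may use finite sums.\<close>

lemma pd_kernel_finite_subsets:
  assumes "\<And>S. finite S \<Longrightarrow> S \<subseteq> X \<Longrightarrow> pd_kernel S N"
  shows "pd_kernel X N"
proof (rule pd_kernelI)
  fix x y assume "x \<in> X" "y \<in> X"
  then show "N x y = N y x" using pd_kernel_sym[OF assms[of "{x, y}"]] by simp
next
  fix n :: nat and x and c :: "nat \<Rightarrow> real" assume "\<And>i. i < n \<Longrightarrow> x i \<in> X"
  then have "pd_kernel (x ` {..<n}) N" by (intro assms) auto
  then show "0 \<le> (\<Sum>i<n. \<Sum>j<n. c i * c j * N (x i) (x j))"
    by (rule pd_kernel_sum_nonneg) simp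
qed

text \<open>What the metric computations use of an address, stated without ordinals so that it is an
  invariant of all stages.\<close>

fun valid_address :: "'j set \<Rightarrow> ('j \<Rightarrow> 'a set) \<Rightarrow> 'j \<Rightarrow> ('j, 'a) address \<Rightarrow> bool" where
  "valid_address J A j0 [] = True"
| "valid_address J A j0 ((x, k) # w) =
    (valid_address J A j0 w \<and> x \<in> A (space_index j0 w) \<and> k \<in> J)"

lemma fp_stage_valid: "w \<in> fp_stage J A j0 \<alpha> \<Longrightarrow> valid_address J A j0 w"
proof -
  have "wf (omega1 - Id)"
    using Well_order_omega1 by (simp add: well_order_on_def)
  then show "w \<in> fp_stage J A j0 \<alpha> \<Longrightarrow> valid_address J A j0 w"
  proof (induction \<alpha> arbitrary: w rule: wf_induct_rule)
    case (less \<alpha>)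
    have IH: "valid_address J A j0 v" if "\<beta> \<in> underS omega1 \<alpha>" "v \<in> fp_stage J A j0 \<beta>" for \<beta> v
      using less.IH[of \<beta> v] that by (simp add: underS_def)
    consider "w = []" | \<beta> where "\<beta> \<in> underS omega1 \<alpha>" "w \<in> fp_stage J A j0 \<beta>"
      | \<beta> where "\<beta> \<in> underS omega1 \<alpha>" "w \<in> new_copies J A j0 (fp_stage J A j0 \<beta>)"
      using less.prems unfolding fp_stage_unfold[of J A j0 \<alpha>] by blast
    then show ?case
    proof cases
      case 3
      then show ?thesis using IH by (auto simp: new_copies_def)
    qed (simp_all add: IH)
  qed
qed

lemma fp_copies_valid: "w \<in> fp_copies J A j0 \<Longrightarrow> valid_address J A j0 w"
  by (auto simp: fp_copies_def intro: fp_stage_valid)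

lemma Nil_in_fp_copies: "[] \<in> fp_copies J A j0"
proof -
  have "infinite (Field omega1)"
    using cardSuc_finite[OF natLeq_Card_order] by (simp add: Field_natLeq)
  then have "Field omega1 \<noteq> {}" by (metis finite.emptyI)
  then obtain \<alpha> where "\<alpha> \<in> Field omega1" by blast
  moreover have "[] \<in> fp_stage J A j0 \<alpha>" unfolding fp_stage_unfold[of J A j0 \<alpha>] by blast
  ultimately show ?thesis by (auto simp: fp_copies_def)
qed

text \<open>
  \<open>copy_proj v w p\<close> is the point at which the copy \<open>v\<close> is left on the way to the point \<open>p\<close> of the
  copy \<open>w\<close>, and \<open>copy_coeff t d b v w p\<close> is \<open>exp (t D)\<close> for its distance \<open>D\<close> to that point, or \<open>0\<close>
  if \<open>w\<close> does not lie beyond \<open>v\<close>.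
\<close>

fun copy_coeff ::
    "real \<Rightarrow> ('j \<Rightarrow> 'a \<Rightarrow> 'a \<Rightarrow> real) \<Rightarrow> ('j \<Rightarrow> 'a) \<Rightarrow> ('j, 'a) address \<Rightarrow> ('j, 'a) address \<Rightarrow> 'a \<Rightarrow> real" where
  "copy_coeff t d b v [] p = (if v = [] then 1 else 0)"
| "copy_coeff t d b v ((x, k) # w) p =
    (if v = (x, k) # w then 1 else exp (t * d k p (b k)) * copy_coeff t d b v w x)"

fun copy_proj :: "('j, 'a) address \<Rightarrow> ('j, 'a) address \<Rightarrow> 'a \<Rightarrow> 'a" where
  "copy_proj v [] p = p"
| "copy_proj v ((x, k) # w) p = (if v = (x, k) # w then p else copy_proj v w x)"

lemma copy_coeff_self [simp]: "copy_coeff t d b w w p = 1"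
  by (cases w) auto

lemma copy_proj_self [simp]: "copy_proj w w p = p"
  by (cases w) auto

text \<open>Addresses grow at the head, so lying beyond \<open>v\<close> means having
  \<open>v\<close> as a suffix.\<close>

lemma copy_coeff_nonzeroD: "copy_coeff t d b v w p \<noteq> 0 \<Longrightarrow> \<exists>u. w = u @ v"
proof (induction w arbitrary: p)
  case Nil
  then show ?case by (auto split: if_splits)
next
  case (Cons y w)
  show ?case
  proof (cases "v = y # w")
    case True
    then show ?thesis by (intro exI[of _ "[]"]) simp
  next
    case False
    then have "copy_coeff t d b v w (fst y) \<noteq> 0" using Cons.prems by (cases y) auto
    then obtain u where "w = u @ v" using Cons.IH by blast
    then show ?thesis by (intro exI[of _ "y # u"]) simp
  qed
qed

lemma copy_coeff_eq_0: "length w \<le> length v \<Longrightarrow> w \<noteq> v \<Longrightarrow> copy_coeff t d b v w p = 0"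
  by (rule ccontr) (auto dest: copy_coeff_nonzeroD)

text \<open>The case split of \<open>copy_dist\<close>: the longer address is peeled, and the first
  one in case of a tie.\<close>

lemma address_pair_cases [case_names same left right]:
  fixes w v :: "('j, 'a) address"
  obtains "w = v"
  | x k u where "w \<noteq> v" "length v \<le> length w" "w = (x, k) # u"
  | x k u where "length w < length v" "v = (x, k) # u"
proof -
  have "w \<noteq> []" if "length v \<le> length w" "w \<noteq> v" using that by auto
  moreover have "v \<noteq> []" if "length w < length v" using that by auto
  ultimately show thesis
    using that by (metis neq_Nil_conv not_le surj_pair)
qed

text \<open>Hyperbolic geometry enters the glueing only through \<open>exp_kernel\<close>; the rest
  is elementary metric data.\<close>

locale glued_spaces =
  fixes J :: "'j set" and M :: "'j \<Rightarrow> 'a set" and d :: "'j \<Rightarrow> 'a \<Rightarrow> 'a \<Rightarrow> real"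
    and b :: "'j \<Rightarrow> 'a" and A :: "'j \<Rightarrow> 'a set" and j0 :: 'j and t :: real
  assumes j0: "j0 \<in> J"
    and b: "j \<in> J \<Longrightarrow> b j \<in> M j"
    and A: "j \<in> J \<Longrightarrow> A j \<subseteq> M j"
    and d_self: "j \<in> J \<Longrightarrow> p \<in> M j \<Longrightarrow> d j p p = 0"
    and d_commute: "j \<in> J \<Longrightarrow> p \<in> M j \<Longrightarrow> q \<in> M j \<Longrightarrow> d j p q = d j q p"
    and d_nonneg: "j \<in> J \<Longrightarrow> p \<in> M j \<Longrightarrow> q \<in> M j \<Longrightarrow> 0 \<le> d j p q"
    and d_eq_0: "j \<in> J \<Longrightarrow> p \<in> M j \<Longrightarrow> q \<in> M j \<Longrightarrow> d j p q = 0 \<Longrightarrow> p = q"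
    and exp_kernel: "j \<in> J \<Longrightarrow> pd_kernel (M j)
      (\<lambda>p q. exp (t * d j p (b j)) * exp (t * d j q (b j)) - exp (t * d j p q))"
begin

abbreviation "idx \<equiv> space_index j0"
abbreviation "valid \<equiv> valid_address J A j0"
abbreviation "D \<equiv> copy_dist d b j0"
abbreviation "pcoeff \<equiv> copy_coeff t d b"
abbreviation "X \<equiv> free_product J M b A j0"
abbreviation "dX \<equiv> fp_dist d b j0"

definition local_kernel :: "('j, 'a) address \<Rightarrow> 'a \<Rightarrow> 'a \<Rightarrow> real" where
  "local_kernel v p q = exp (t * d (idx v) p (b (idx v))) * exp (t * d (idx v) q (b (idx v)))
     - exp (t * d (idx v) p q)"

lemma idx_in: "valid w \<Longrightarrow> idx w \<in> J"
  by (cases w) (auto simp: j0)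

lemma valid_ConsD:
  assumes "valid ((x, k) # w)"
  shows "valid w" "x \<in> M (idx w)" "k \<in> J"
  using assms A[OF idx_in] by auto

lemma valid_append: "valid (u @ v) \<Longrightarrow> valid v"
  by (induction u) auto

lemma copy_dist_self: "valid w \<Longrightarrow> p \<in> M (idx w) \<Longrightarrow> D w p w p = 0"
  by (subst copy_dist.simps) (simp add: d_self idx_in)

lemma copy_dist_left:
  "length v \<le> length ((x, k) # w) \<Longrightarrow> (x, k) # w \<noteq> v \<Longrightarrow>
    D ((x, k) # w) p v q = d k p (b k) + D w x v q"
  by (subst copy_dist.simps) auto

lemma copy_dist_right:
  "length w < length ((x, k) # v) \<Longrightarrow> D w p ((x, k) # v) q = D w p v x + d k (b k) q"
  by (subst copy_dist.simps) auto

text \<open>With coefficient 0, \<open>w\<close> need not lie beyond \<open>v\<close>, and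
  \<open>copy_proj\<close> may descend to a point of the initial copy instead.\<close>

lemma copy_proj_in:
  assumes "pcoeff v w p \<noteq> 0" "valid w" "p \<in> M (idx w)"
  shows "copy_proj v w p \<in> M (idx v)"
  using assms
proof (induction w arbitrary: p)
  case Nil
  then show ?case by (auto split: if_splits)
next
  case (Cons y w)
  obtain x k where y: "y = (x, k)" by (cases y)
  show ?case
  proof (cases "v = y # w")
    case True
    show ?thesis using Cons.prems(3) by (simp only: True copy_proj_self)
  next
    case False
    have "pcoeff v w x \<noteq> 0" using Cons.prems(1) False by (auto simp: y)
    then have "copy_proj v w x \<in> M (idx v)"
      using valid_ConsD[OF Cons.prems(2)[unfolded y]] by (intro Cons.IH)
    then show ?thesis using False by (simp add: y)
  qed
qed

text \<open>
  The kernel of the glued space splits along the copies: as \<open>exp (t d)\<close> is multiplicative across a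
  glueing point, the parts beyond different copies are orthogonal.
\<close>

lemma kernel_decomposition:
  assumes "finite V" "\<And>u s. w = u @ s \<Longrightarrow> s \<in> V"
    and "valid w" "valid v" "p \<in> M (idx w)" "q \<in> M (idx v)"
  shows "exp (t * D w p [] (b j0)) * exp (t * D v q [] (b j0)) - exp (t * D w p v q) =
    (\<Sum>s\<in>V. pcoeff s w p * pcoeff s v q * local_kernel s (copy_proj s w p) (copy_proj s v q))"
  using assms(2-)
proof (induction "length w + length v" arbitrary: w v p q rule: less_induct)
  case less
  have depth_Cons: "D ((x, k) # u) r [] (b j0) = d k r (b k) + D u x [] (b j0)" for x k u r
    by (rule copy_dist_left) auto
  let ?T = "\<lambda>w p v q s. pcoeff s w p * pcoeff s v q * local_kernel s (copy_proj s w p) (copy_proj s v q)"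
  show ?case
  proof (cases w v rule: address_pair_cases)
    case same
    show ?thesis
    proof (cases w)
      case Nil
      have D: "D [] r [] r' = d j0 r r'" for r r'
        by (subst copy_dist.simps) simp
      note Nil = same Nil
      have "[] \<in> V" using less.prems(1)[of w "[]"] by simp
      have "(\<Sum>s\<in>V. ?T w p v q s) = (\<Sum>s\<in>{[]}. ?T w p v q s)"
        using \<open>finite V\<close> \<open>[] \<in> V\<close> Nil by (intro sum.mono_neutral_right) auto
      then show ?thesis using Nil by (simp add: D local_kernel_def)
    next
      case (Cons y u)
      obtain x k where y: "y = (x, k)" by (cases y)
      note Cons = same Cons[unfolded y]
      have "valid ((x, k) # u)" using less.prems(2) Cons by simp
      note u = valid_ConsD[OF this]
      have "w \<in> V" using less.prems(1)[of "[]" w] by simp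
      \<comment> \<open>Copies other than \<open>w\<close> see \<open>p\<close> and \<open>q\<close>
        only through the glueing point \<open>x\<close>, with coefficients scaled by two
        exponentials; \<open>w\<close> itself adds its local kernel.\<close>
      have IH: "exp (t * D u x [] (b j0)) * exp (t * D u x [] (b j0)) - exp (t * D u x u x) = (\<Sum>s\<in>V. ?T u x u x s)"
      proof (rule less.hyps)
        show "s \<in> V" if "u = u' @ s" for u' s
          using less.prems(1)[of "(x, k) # u'" s] Cons that by simp
        show "length u + length u < length w + length v" using Cons by auto
      qed (use less.prems(2-) Cons u in simp_all)
      \<comment> \<open>This allows the index \<open>w\<close> to be put back into the sum of the
        remaining terms.\<close>
      have "pcoeff w u x = 0" using Cons by (intro copy_coeff_eq_0) auto
      have "(\<Sum>s\<in>V. ?T w p v q s) = ?T w p v q w + (\<Sum>s\<in>V - {w}. ?T w p v q s)"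
        using \<open>finite V\<close> \<open>w \<in> V\<close> by (rule sum.remove)
      also have "(\<Sum>s\<in>V - {w}. ?T w p v q s) =
          (\<Sum>s\<in>V - {w}. exp (t * d k p (b k)) * exp (t * d k q (b k)) * ?T u x u x s)"
        using Cons by (intro sum.cong refl) auto
      also have "\<dots> = exp (t * d k p (b k)) * exp (t * d k q (b k)) * (\<Sum>s\<in>V. ?T u x u x s)"
        using \<open>finite V\<close> \<open>w \<in> V\<close> \<open>pcoeff w u x = 0\<close> by (simp add: sum_distrib_left sum.remove[of V w])
      also have "\<dots> = exp (t * D w p [] (b j0)) * exp (t * D v q [] (b j0)) - exp (t * d k p (b k)) * exp (t * d k q (b k))"
      proof -
        have "D w p [] (b j0) = d k p (b k) + D u x [] (b j0)" "D v q [] (b j0) = d k q (b k) + D u x [] (b j0)"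
          using Cons depth_Cons by auto
        moreover have "D u x u x = 0" using u by (intro copy_dist_self)
        ultimately show ?thesis unfolding IH[symmetric] by (simp add: algebra_simps exp_add)
      qed
      also have "?T w p v q w = exp (t * d k p (b k)) * exp (t * d k q (b k)) - exp (t * D w p v q)"
      proof -
        have "idx v = k" using Cons by auto
        then show ?thesis using Cons(1) by (simp add: local_kernel_def copy_dist.simps)
      qed
      finally show ?thesis by simp
    qed
  next
    case (left x k u)
    have "valid ((x, k) # u)" using less.prems(2) left by simp
    note u = valid_ConsD[OF this]
    have IH: "exp (t * D u x [] (b j0)) * exp (t * D v q [] (b j0)) - exp (t * D u x v q) = (\<Sum>s\<in>V. ?T u x v q s)"
    proof (rule less.hyps)
      show "s \<in> V" if "u = u' @ s" for u' s
        using less.prems(1)[of "(x, k) # u'" s] left that by simp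
    qed (use less.prems(2-) left u in simp_all)
    \<comment> \<open>\<open>v\<close> does not lie beyond \<open>w\<close>, so the term of
      \<open>w\<close> vanishes and all others gain one common factor.\<close>
    have "pcoeff w v q = 0" using left by (intro copy_coeff_eq_0) auto
    then have "(\<Sum>s\<in>V. ?T w p v q s) = (\<Sum>s\<in>V. exp (t * d k p (b k)) * ?T u x v q s)"
      using left by (intro sum.cong refl) auto
    also have "\<dots> = exp (t * d k p (b k)) * (\<Sum>s\<in>V. ?T u x v q s)" by (simp add: sum_distrib_left)
    finally show ?thesis
      unfolding IH[symmetric] using left copy_dist_left[of v x k u p q]
      by (simp add: depth_Cons algebra_simps exp_add)
  next
    case (right x k u)
    have "valid ((x, k) # u)" using less.prems(3) right by simp
    note u = valid_ConsD[OF this]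
    have IH: "exp (t * D w p [] (b j0)) * exp (t * D u x [] (b j0)) - exp (t * D w p u x) = (\<Sum>s\<in>V. ?T w p u x s)"
      by (rule less.hyps) (use less.prems right u in simp_all)
    have "pcoeff v w p = 0" using right by (intro copy_coeff_eq_0) auto
    then have "(\<Sum>s\<in>V. ?T w p v q s) = (\<Sum>s\<in>V. exp (t * d k q (b k)) * ?T w p u x s)"
      using right by (intro sum.cong refl) auto
    also have "\<dots> = exp (t * d k q (b k)) * (\<Sum>s\<in>V. ?T w p u x s)" by (simp add: sum_distrib_left)
    finally have "(\<Sum>s\<in>V. ?T w p v q s) = exp (t * d k q (b k)) * (\<Sum>s\<in>V. ?T w p u x s)" .
    \<comment> \<open>\<open>copy_dist\<close> measures the last segment from the base point,
      \<open>copy_coeff\<close> towards it.\<close>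
    moreover have "d k (b k) q = d k q (b k)"
      using less.prems(5) right by (intro d_commute b u(3)) simp
    ultimately show ?thesis
      unfolding IH[symmetric] using right copy_dist_right[of w x k u p q]
      by (simp add: depth_Cons algebra_simps exp_add)
  qed
qed

abbreviation "base \<equiv> ([], b j0)"

lemma base_in: "base \<in> X"
  by (simp add: free_product_def Nil_in_fp_copies b j0)

lemma mem_XD:
  assumes "x \<in> X"
  shows "valid (fst x)" "snd x \<in> M (idx (fst x))" "fst x \<noteq> [] \<Longrightarrow> snd x \<noteq> b (idx (fst x))"
  using assms by (auto simp: free_product_def fp_copies_valid)

theorem free_product_exp_kernel:
  "pd_kernel X (\<lambda>x y. exp (t * dX x base) * exp (t * dX y base) - exp (t * dX x y))"
proof (rule pd_kernel_finite_subsets)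
  fix S assume "finite S" "S \<subseteq> X"
  \<comment> \<open>All suffixes: the copies crossed on the way from points of \<open>S\<close> to
    the initial copy.\<close>
  define V where "V = (\<Union>x\<in>S. (\<lambda>n. drop n (fst x)) ` {..length (fst x)})"
  have "finite V" using \<open>finite S\<close> by (simp add: V_def)
  have V: "s \<in> V" if "x \<in> S" "fst x = u @ s" for x u s
  proof -
    have "s = drop (length u) (fst x)" "length u \<le> length (fst x)" using that(2) by simp_all
    then show ?thesis using \<open>x \<in> S\<close> unfolding V_def by blast
  qed
  have "pd_kernel S (\<lambda>x y. pcoeff s (fst x) (snd x) * pcoeff s (fst y) (snd y) *
      local_kernel s (copy_proj s (fst x) (snd x)) (copy_proj s (fst y) (snd y)))" if "s \<in> V" for s
  proof (rule pd_kernel_weighted_pullback)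
    have "\<exists>x\<in>S. \<exists>u. fst x = u @ s"
      using that unfolding V_def by (auto simp del: append_take_drop_id) (metis append_take_drop_id fst_conv)
    then have "valid s" using mem_XD(1) \<open>S \<subseteq> X\<close> valid_append by (metis subsetD)
    moreover have "local_kernel s = (\<lambda>p q. exp (t * d (idx s) p (b (idx s))) * exp (t * d (idx s) q (b (idx s)))
        - exp (t * d (idx s) p q))"
      by (intro ext) (simp add: local_kernel_def)
    ultimately show "pd_kernel (M (idx s)) (local_kernel s)"
      using exp_kernel[OF idx_in] by simp
  next
    fix x assume "x \<in> S" "pcoeff s (fst x) (snd x) \<noteq> 0"
    moreover from \<open>x \<in> S\<close> \<open>S \<subseteq> X\<close> have "x \<in> X" by blast
    ultimately show "copy_proj s (fst x) (snd x) \<in> M (idx s)"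
      by (intro copy_proj_in mem_XD)
  qed
  then have "pd_kernel S (\<lambda>x y. \<Sum>s\<in>V. pcoeff s (fst x) (snd x) * pcoeff s (fst y) (snd y) *
      local_kernel s (copy_proj s (fst x) (snd x)) (copy_proj s (fst y) (snd y)))"
    by (rule pd_kernel_sum[OF \<open>finite V\<close>])
  then show "pd_kernel S (\<lambda>x y. exp (t * dX x base) * exp (t * dX y base) - exp (t * dX x y))"
  proof (rule pd_kernel_cong)
    fix x y assume "x \<in> S" "y \<in> S"
    then have "x \<in> X" "y \<in> X" using \<open>S \<subseteq> X\<close> by auto
    then show "(\<Sum>s\<in>V. pcoeff s (fst x) (snd x) * pcoeff s (fst y) (snd y) *
        local_kernel s (copy_proj s (fst x) (snd x)) (copy_proj s (fst y) (snd y))) =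
        exp (t * dX x base) * exp (t * dX y base) - exp (t * dX x y)"
      unfolding fp_dist_def fst_conv snd_conv
      by (intro kernel_decomposition[symmetric] \<open>finite V\<close> mem_XD V[OF \<open>x \<in> S\<close>])
  qed
qed

section \<open>Definiteness of the glued distance\<close>

lemma copy_dist_nonneg:
  assumes "valid w" "valid v" "p \<in> M (idx w)" "q \<in> M (idx v)"
  shows "0 \<le> D w p v q"
  using assms
proof (induction "length w + length v" arbitrary: w v p q rule: less_induct)
  case less
  show ?case
  proof (cases w v rule: address_pair_cases)
    case same
    then show ?thesis using less.prems by (simp add: copy_dist.simps d_nonneg idx_in)
  next
    case (left x k u)
    have "valid ((x, k) # u)" using less.prems(1) left by simp
    note u = valid_ConsD[OF this]
    show ?thesis
      using less.hyps[of u v x q] u less.prems(2-) left copy_dist_left[of v x k u p q]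
        d_nonneg[of k p "b k"] b[OF u(3)]
      by simp
  next
    case (right x k u)
    have "valid ((x, k) # u)" using less.prems(2) right by simp
    note u = valid_ConsD[OF this]
    show ?thesis
      using less.hyps[of w u p x] u less.prems right copy_dist_right[of w x k u p q]
        d_nonneg[of k "b k" q] b[OF u(3)]
      by simp
  qed
qed

lemma fp_dist_self: "x \<in> X \<Longrightarrow> dX x x = 0"
  using mem_XD[of x] by (simp add: fp_dist_def copy_dist_self)

lemma fp_dist_nonneg: "x \<in> X \<Longrightarrow> y \<in> X \<Longrightarrow> 0 \<le> dX x y"
  using mem_XD[of x] mem_XD[of y] by (simp add: fp_dist_def copy_dist_nonneg)

text \<open>Between different copies, the outermost segment has positive length because a
  representative in a glued copy is never its base point.\<close>

lemma fp_dist_eq_0: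
  assumes "x \<in> X" "y \<in> X" "dX x y = 0"
  shows "x = y"
proof -
  obtain w p v q where xy: "x = (w, p)" "y = (v, q)" by (cases x; cases y)
  note wp = mem_XD[OF assms(1), unfolded xy fst_conv snd_conv]
  note vq = mem_XD[OF assms(2), unfolded xy fst_conv snd_conv]
  have 0: "D w p v q = 0" using assms(3) by (simp add: xy fp_dist_def)
  have pos: "0 < d j r s" if "j \<in> J" "r \<in> M j" "s \<in> M j" "r \<noteq> s" for j r s
    using d_nonneg[OF that(1-3)] d_eq_0[OF that(1-3)] that(4) by force
  show ?thesis
  proof (cases w v rule: address_pair_cases)
    case same
    then show ?thesis using 0 wp vq d_eq_0[OF idx_in[of w]] by (simp add: xy copy_dist.simps)
  next
    case (left z k u)
    have "valid ((z, k) # u)" using wp left by simp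
    note u = valid_ConsD[OF this]
    have "0 < d k p (b k)" using wp left b[OF u(3)] by (intro pos u(3)) auto
    moreover have "0 \<le> D u z v q" using vq u by (intro copy_dist_nonneg)
    ultimately show ?thesis using 0 left copy_dist_left[of v z k u p q] by simp
  next
    case (right z k u)
    have "valid ((z, k) # u)" using vq right by simp
    note u = valid_ConsD[OF this]
    have "0 < d k (b k) q" using vq right b[OF u(3)] by (intro pos u(3)) auto
    moreover have "0 \<le> D w p u z" using wp u by (intro copy_dist_nonneg)
    ultimately show ?thesis using 0 right copy_dist_right[of w z k u p q] by simp
  qed
qed

end

section \<open>Equivariant embeddings\<close>

text \<open>The realization names coordinates by points; here they are renamed into a prescribed
  index type.\<close>

lemma pd_kernel_realization_indexed:
  fixes N :: "'a \<Rightarrow> 'a \<Rightarrow> real" and enc :: "'a \<Rightarrow> 'i"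
  assumes N: "pd_kernel X N" and "inj enc"
  obtains \<phi> :: "'a \<Rightarrow> 'i l2" and I where
    "\<And>x y. x \<in> X \<Longrightarrow> y \<in> X \<Longrightarrow> inner (\<phi> x) (\<phi> y) = N x y"
    "\<phi> ` X \<subseteq> supp_l2 I" "unit_l2 ` I \<subseteq> closure (span (\<phi> ` X))"
proof -
  have "pd_kernel (enc ` X) (\<lambda>i j. 1 * 1 * N (inv_into UNIV enc i) (inv_into UNIV enc j))"
    by (rule pd_kernel_weighted_pullback[OF N, of _ "\<lambda>_. 1"]) (auto simp: inv_f_f[OF \<open>inj enc\<close>])
  then obtain \<psi> :: "'i \<Rightarrow> 'i l2" and I where
    \<psi>: "\<And>i j. i \<in> enc ` X \<Longrightarrow> j \<in> enc ` X \<Longrightarrow> inner (\<psi> i) (\<psi> j) = 1 * 1 * N (inv_into UNIV enc i) (inv_into UNIV enc j)"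
      "\<psi> ` enc ` X \<subseteq> supp_l2 I" "unit_l2 ` I \<subseteq> closure (span (\<psi> ` enc ` X))"
    by (rule pd_kernel_realization) blast
  show thesis
  proof (rule that[of "\<lambda>x. \<psi> (enc x)" I])
    fix x y assume "x \<in> X" "y \<in> X"
    then show "inner (\<psi> (enc x)) (\<psi> (enc y)) = N x y"
      using \<psi>(1)[of "enc x" "enc y"] by (simp add: inv_f_f[OF \<open>inj enc\<close>])
  qed (use \<psi>(2,3) in \<open>simp_all add: image_image\<close>)
qed

section \<open>The Lorentz form on the ambient space\<close>

lemma lor_0_left [simp]: "lor 0 Z = 0"
  by (simp add: lor_def)

lemma lor_add_left: "lor (Y + Y') Z = lor Y Z + lor Y' Z"
  and lor_add_right: "lor Z (Y + Y') = lor Z Y + lor Z Y'"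
  and lor_diff_left: "lor (Y - Y') Z = lor Y Z - lor Y' Z"
  by (simp_all add: lor_def algebra_simps inner_add_left inner_add_right inner_diff_left)

lemma lor_sum_left: "lor (\<Sum>i\<in>S. c i *\<^sub>R u i) Z = (\<Sum>i\<in>S. c i * lor (u i) Z)"
proof (cases "finite S")
  case True
  then show ?thesis by (induction S rule: finite_induct) (simp_all add: lor_add_left)
qed simp

lemma continuous_lor [continuous_intros]:
  "continuous_on S f \<Longrightarrow> continuous_on S g \<Longrightarrow> continuous_on S (\<lambda>x. lor (f x) (g x))"
  unfolding lor_def by (intro continuous_intros)

text \<open>The operator relating \<open>lor\<close> to \<open>inner\<close>; through it
  Cauchy-Schwarz and the Riesz representation serve the indefinite form.\<close>

definition lor_flip :: "real \<times> 'i l2 \<Rightarrow> real \<times> 'i l2" where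
  "lor_flip Y = (fst Y, - snd Y)"

lemma lor_flip_left: "lor (lor_flip Y) Z = inner Y Z"
  and inner_lor_flip: "inner (lor_flip Y) Z = lor Y Z"
  by (simp_all add: lor_def lor_flip_def inner_prod_def)

lemma norm_lor_flip [simp]: "norm (lor_flip Y) = norm Y"
  by (simp add: lor_flip_def norm_prod_def)

lemma lor_le_norm: "\<bar>lor Y Z\<bar> \<le> norm Y * norm Z"
  using Cauchy_Schwarz_ineq2[of "lor_flip Y" Z] by (simp add: inner_lor_flip)

lemma power2_norm_lor: "(norm Y)\<^sup>2 = 2 * (fst Y)\<^sup>2 - lor Y Y"
  unfolding power2_norm_eq_inner by (simp add: lor_def inner_prod_def power2_eq_square)

text \<open>Totality of the space parts does not by itself reach the time axis;
  \<open>F e = (1, 0)\<close> supplies it.\<close>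

lemma closure_span_eq_lorentz_space:
  fixes F :: "'a \<Rightarrow> real \<times> 'i l2"
  assumes F: "\<And>x. x \<in> X \<Longrightarrow> snd (F x) \<in> supp_l2 I"
    and unit: "unit_l2 ` I \<subseteq> closure (span ((\<lambda>x. snd (F x)) ` X))"
    and e: "e \<in> X" "F e = (1, 0)"
  shows "closure (span (F ` X)) = {Y. snd Y \<in> supp_l2 I}"
proof
  have W: "subspace {Y :: real \<times> 'i l2. snd Y \<in> supp_l2 I}"
    using subspace_supp_l2[of I] by (auto simp: subspace_def)
  have "closed {Y :: real \<times> 'i l2. snd Y \<in> supp_l2 I}"
    using closed_vimage[OF closed_supp_l2, of snd I] by (simp add: vimage_def continuous_on_snd)
  then show sub: "closure (span (F ` X)) \<subseteq> {Y. snd Y \<in> supp_l2 I}"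
    using F by (intro closure_span_minimal W) auto
  show "{Y. snd Y \<in> supp_l2 I} \<subseteq> closure (span (F ` X))"
  proof
    fix Z assume Z: "Z \<in> {Y :: real \<times> 'i l2. snd Y \<in> supp_l2 I}"
    have bound: "(\<Sum>i<n. c i * inner Z (F (x i)))\<^sup>2 \<le> (norm Z)\<^sup>2 * (norm (\<Sum>i<n. c i *\<^sub>R F (x i)))\<^sup>2"
      for n :: nat and x c
      using Cauchy_Schwarz_ineq[of Z "\<Sum>i<n. c i *\<^sub>R F (x i)"]
      by (simp add: inner_sum_right power2_norm_eq_inner)
    obtain h where h: "h \<in> closure (span (F ` X))" "\<And>x. x \<in> X \<Longrightarrow> inner h (F x) = inner Z (F x)"
      using Riesz_representation_family[where \<phi> = F and L = "\<lambda>x. inner Z (F x)" and X = X,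
          OF bound zero_le_power2] by blast
    \<comment> \<open>The defect is orthogonal to every \<open>F x\<close>: \<open>F e\<close> kills
      its time coordinate, and then the unit vectors kill the others.\<close>
    define k where "k = Z - h"
    have k: "inner k (F x) = 0" if "x \<in> X" for x
      using h(2)[OF that] by (simp add: k_def inner_diff_left)
    have "fst k = 0" using k[OF e(1)] by (simp add: e(2) inner_prod_def)
    have "closure (span ((\<lambda>x. snd (F x)) ` X)) \<subseteq> {u. inner (snd k) u = 0}"
    proof (rule closure_span_minimal)
      show "subspace {u. inner (snd k) u = 0}"
        by (simp add: subspace_def inner_add_right)
      show "closed {u. inner (snd k) u = 0}"
        by (intro closed_Collect_eq continuous_intros)
      show "(\<lambda>x. snd (F x)) ` X \<subseteq> {u. inner (snd k) u = 0}"
        using k \<open>fst k = 0\<close> by (auto simp: inner_prod_def)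
    qed
    then have "coord (snd k) i = 0" if "i \<in> I" for i
      using unit that by (auto simp flip: inner_unit_right)
    moreover have "coord (snd k) i = 0" if "i \<notin> I" for i
      using that Z h(1) sub by (auto simp: k_def supp_l2_def)
    ultimately have "snd k = 0" by (intro l2_eqI) auto
    then have "k = 0" using \<open>fst k = 0\<close> by (simp add: prod_eq_iff)
    then show "Z \<in> closure (span (F ` X))" using h(1) by (simp add: k_def)
  qed
qed

text \<open>\<open>T\<close> is total on the type so that \<open>bounded_linear\<close> applies, but
  the form need only be preserved on the subspace that the \<open>F x\<close> generate.\<close>

definition extends_isometry ::
    "'a set \<Rightarrow> 'i set \<Rightarrow> ('a \<Rightarrow> real \<times> 'i l2) \<Rightarrow> ('a \<Rightarrow> 'a) \<Rightarrow> (real \<times> 'i l2 \<Rightarrow> real \<times> 'i l2) \<Rightarrow> bool" where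
  "extends_isometry X I F g T \<longleftrightarrow> bounded_linear T \<and> (\<forall>x\<in>X. T (F x) = F (g x)) \<and>
     (\<forall>Y. snd (T Y) \<in> supp_l2 I) \<and>
     (\<forall>Y Z. snd Y \<in> supp_l2 I \<longrightarrow> snd Z \<in> supp_l2 I \<longrightarrow> lor (T Y) (T Z) = lor Y Z)"

text \<open>
  \<open>T Y\<close> is determined by \<open>lor (T Y) (F (g x)) = lor Y (F x)\<close>. Its existence needs a bound for the
  norm of a combination of the \<open>F x\<close> by that of the \<open>F (g x)\<close>; it comes from the invariance of \<open>lor\<close>
  and \<open>\<parallel>Y\<parallel>\<^sup>2 = 2 (lor Y (F e))\<^sup>2 - lor Y Y\<close>.
\<close>

theorem extends_isometry_exists:
  fixes F :: "'a \<Rightarrow> real \<times> 'i l2"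
  assumes total: "closure (span (F ` X)) = {Y. snd Y \<in> supp_l2 I}"
    and e: "e \<in> X" "F e = (1, 0)"
    and g: "g ` X = X" "\<And>x y. x \<in> X \<Longrightarrow> y \<in> X \<Longrightarrow> lor (F (g x)) (F (g y)) = lor (F x) (F y)"
  shows "\<exists>T. extends_isometry X I F g T"
proof -
  \<comment> \<open>Read off from the estimate of \<open>norm v\<close> below: 2 comes from the
    squared time coordinate, 1 from \<open>lor v' v'\<close>.\<close>
  define K where "K = 2 * (norm (F (g e)))\<^sup>2 + 1"
  have "0 \<le> K" by (simp add: K_def)
  have span_g: "(\<lambda>x. F (g x)) ` X = F ` X" using g(1) by (metis image_image)
  \<comment> \<open>Nondegeneracy of \<open>lor\<close>: since \<open>g\<close> permutes
    \<open>X\<close>, the vectors \<open>F (g x)\<close> are as total as the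
    \<open>F x\<close>.\<close>
  have uniq: "Y = Z" if "snd Y \<in> supp_l2 I" "snd Z \<in> supp_l2 I" "\<And>x. x \<in> X \<Longrightarrow> lor Y (F (g x)) = lor Z (F (g x))" for Y Z
  proof -
    define k where "k = lor_flip (Y - Z)"
    have "snd k \<in> supp_l2 I"
      using that(1,2) by (simp add: k_def lor_flip_def supp_l2_def)
    then have "k \<in> closure (span (F ` X))" using total by blast
    moreover have "closure (span (F ` X)) \<subseteq> {v. inner k v = 0}"
    proof (rule closure_span_minimal)
      show "subspace {v. inner k v = 0}" by (simp add: subspace_def inner_add_right)
      show "closed {v. inner k v = 0}" by (intro closed_Collect_eq continuous_intros)
      show "F ` X \<subseteq> {v. inner k v = 0}"
        unfolding span_g[symmetric] using that(3) by (auto simp: k_def inner_lor_flip lor_diff_left)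
    qed
    ultimately have "k = 0" by auto
    then show ?thesis by (simp add: k_def lor_flip_def prod_eq_iff)
  qed
  have "\<exists>Y'. snd Y' \<in> supp_l2 I \<and> (norm Y')\<^sup>2 \<le> (norm Y)\<^sup>2 * K \<and> (\<forall>x\<in>X. lor Y' (F (g x)) = lor Y (F x))" for Y
  proof -
    have bound: "(\<Sum>i<n. c i * lor Y (F (x i)))\<^sup>2 \<le> (norm Y)\<^sup>2 * K * (norm (\<Sum>i<n. c i *\<^sub>R F (g (x i))))\<^sup>2"
      if x: "\<And>i. i < n \<Longrightarrow> x i \<in> X" for n :: nat and x c
    proof -
      define v where "v = (\<Sum>i<n. c i *\<^sub>R F (x i))"
      define v' where "v' = (\<Sum>i<n. c i *\<^sub>R F (g (x i)))"
      have "lor v' v' = lor v v"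
        unfolding v_def v'_def lor_sum_left lor_commute[of "F _" "sum _ _"] lor_commute[of "F (g _)" "sum _ _"]
        by (intro sum.cong refl) (simp add: x g(2))
      \<comment> \<open>The time coordinate is itself a product with \<open>F e\<close>, so it can
        be expressed after applying \<open>g\<close>.\<close>
      moreover have "fst v = lor v' (F (g e))"
      proof -
        have "fst v = lor v (F e)" by (simp add: lor_def e(2))
        also have "\<dots> = lor v' (F (g e))"
          unfolding v_def v'_def lor_sum_left by (intro sum.cong refl) (simp add: x g(2) e(1))
        finally show ?thesis .
      qed
      ultimately have "(norm v)\<^sup>2 = 2 * (lor v' (F (g e)))\<^sup>2 - lor v' v'"
        by (simp add: power2_norm_lor)
      also have "\<dots> \<le> 2 * (norm v' * norm (F (g e)))\<^sup>2 + norm v' * norm v'"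
        using power_mono[OF lor_le_norm[of v' "F (g e)"] abs_ge_zero, of 2] lor_le_norm[of v' v'] by simp
      also have "\<dots> = K * (norm v')\<^sup>2"
        by (simp add: K_def algebra_simps power2_eq_square)
      finally have "(norm v)\<^sup>2 \<le> K * (norm v')\<^sup>2" .
      moreover have "(\<Sum>i<n. c i * lor Y (F (x i))) = lor v Y"
        by (simp add: v_def lor_sum_left lor_commute[of Y])
      moreover have "(lor v Y)\<^sup>2 \<le> (norm v * norm Y)\<^sup>2"
        using power_mono[OF lor_le_norm[of v Y] abs_ge_zero, of 2] by simp
      ultimately show ?thesis
        using mult_left_mono[of "(norm v)\<^sup>2" "K * (norm v')\<^sup>2" "(norm Y)\<^sup>2"]
        by (simp add: v'_def power_mult_distrib mult_ac)
    qed
    have "0 \<le> (norm Y)\<^sup>2 * K" using \<open>0 \<le> K\<close> by simp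
    then obtain h where h: "h \<in> closure (span ((\<lambda>x. F (g x)) ` X))" "(norm h)\<^sup>2 \<le> (norm Y)\<^sup>2 * K"
      "\<And>x. x \<in> X \<Longrightarrow> inner h (F (g x)) = lor Y (F x)"
      using Riesz_representation_family[where \<phi> = "\<lambda>x. F (g x)" and L = "\<lambda>x. lor Y (F x)" and X = X, OF bound] by blast
    have "snd h \<in> supp_l2 I" using h(1) unfolding span_g total by simp
    \<comment> \<open>\<open>h\<close> solves the equations for \<open>inner\<close>; its flip
      solves them for \<open>lor\<close>.\<close>
    then have "snd (lor_flip h) \<in> supp_l2 I" by (simp add: lor_flip_def supp_l2_def)
    then show ?thesis
      using h(2,3) by (intro exI[of _ "lor_flip h"]) (simp add: lor_flip_left)
  qed
  then obtain T where T: "\<And>Y. snd (T Y) \<in> supp_l2 I" "\<And>Y. (norm (T Y))\<^sup>2 \<le> (norm Y)\<^sup>2 * K"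
    "\<And>Y x. x \<in> X \<Longrightarrow> lor (T Y) (F (g x)) = lor Y (F x)"
    by metis
  \<comment> \<open>\<open>T\<close> was obtained by mere choice; it is linear because both sides
    solve the same equations.\<close>
  have "bounded_linear T"
  proof (rule bounded_linear_intro)
    show "T (Y + Z) = T Y + T Z" for Y Z
      using T(1) by (intro uniq) (simp_all add: T(3) lor_add_left subspace_add[OF subspace_supp_l2])
    show "T (r *\<^sub>R Y) = r *\<^sub>R T Y" for r Y
      using T(1) by (intro uniq) (simp_all add: T(3) subspace_mul[OF subspace_supp_l2])
    show "norm (T Y) \<le> norm Y * sqrt K" for Y
      using real_sqrt_le_mono[OF T(2), of Y] by (simp add: real_sqrt_mult)
  qed
  have T_F: "T (F x) = F (g x)" if "x \<in> X" for x
  proof (rule uniq)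
    have "F (g x) \<in> closure (span (F ` X))"
      using that g(1) by (intro subsetD[OF closure_subset] span_base) blast
    then show "snd (F (g x)) \<in> supp_l2 I" using total by simp
  qed (simp_all add: T that g(2))
  have "lor (T Y) (T Z) = lor Y Z" if "snd Z \<in> supp_l2 I" for Y Z
  proof -
    have T_lin: "T (u + v) = T u + T v" "T (c *\<^sub>R u) = c *\<^sub>R T u" "T 0 = 0" for u v c
      using \<open>bounded_linear T\<close> by (simp_all add: linear_simps)
    have "closure (span (F ` X)) \<subseteq> {Z. lor (T Y) (T Z) = lor Y Z}"
    proof (rule closure_span_minimal)
      show "subspace {Z. lor (T Y) (T Z) = lor Y Z}"
        by (simp add: subspace_def T_lin lor_add_right) (simp add: lor_def)
      show "closed {Z. lor (T Y) (T Z) = lor Y Z}"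
        by (intro closed_Collect_eq continuous_intros bounded_linear.continuous_on[OF \<open>bounded_linear T\<close>])
      show "F ` X \<subseteq> {Z. lor (T Y) (T Z) = lor Y Z}"
        by (auto simp: T_F T(3))
    qed
    then show ?thesis using that unfolding total by blast
  qed
  then have "extends_isometry X I F g T"
    unfolding extends_isometry_def using \<open>bounded_linear T\<close> T_F T(1) by blast
  then show ?thesis by blast
qed

lemma bounded_linear_eq_on_closure_span:
  assumes "bounded_linear S" "bounded_linear T" "\<And>v. v \<in> A \<Longrightarrow> S v = T v" "u \<in> closure (span A)"
  shows "S u = T u"
proof -
  have "closure (span A) \<subseteq> {v. S v - T v = 0}"
  proof (rule closure_span_minimal)
    show "subspace {v. S v - T v = 0}"
      using assms(1,2) by (simp add: subspace_def linear_simps)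
    show "closed {v. S v - T v = 0}"
      by (intro closed_Collect_eq continuous_intros bounded_linear.continuous_on[OF assms(1)]
          bounded_linear.continuous_on[OF assms(2)])
    show "A \<subseteq> {v. S v - T v = 0}" using assms(3) by auto
  qed
  then show ?thesis using assms(4) by auto
qed

text \<open>The projective action. The chosen representative is immaterial because a linear
  \<open>T\<close> commutes with scaling.\<close>

definition class_map :: "(real \<times> 'i l2 \<Rightarrow> real \<times> 'i l2) \<Rightarrow> 'i hpoint \<Rightarrow> 'i hpoint" where
  "class_map T P = lor_class (T (SOME Y. P = lor_class Y))"

lemma class_map_lor_class:
  assumes "bounded_linear T"
  shows "class_map T (lor_class Y) = lor_class (T Y)"
proof -
  have "lor_class Y = lor_class (SOME Z. lor_class Y = lor_class Z)" by (rule someI) (rule refl)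
  then obtain c where "c \<noteq> 0" "(SOME Z. lor_class Y = lor_class Z) = c *\<^sub>R Y"
    using lor_class_eqD by metis
  then show ?thesis
    using assms by (simp add: class_map_def linear_simps lor_class_scaleR)
qed

section \<open>Isometry groups and the representation\<close>

lemma carrier_isometry_group:
  "g \<in> carrier (isometry_group M d) \<longleftrightarrow>
    g \<in> extensional M \<and> bij_betw g M M \<and> (\<forall>x\<in>M. \<forall>y\<in>M. d (g x) (g y) = d x y)"
  by (auto simp: isometry_group_def Bij_def)

lemma mult_isometry_group:
  "g \<in> carrier (isometry_group M d) \<Longrightarrow> h \<in> carrier (isometry_group M d) \<Longrightarrow>
    g \<otimes>\<^bsub>isometry_group M d\<^esub> h = compose M g h"
  by (simp add: isometry_group_def BijGroup_def)

lemma compose_in_isometry_group: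
  "g \<in> carrier (isometry_group M d) \<Longrightarrow> h \<in> carrier (isometry_group M d) \<Longrightarrow>
    compose M g h \<in> carrier (isometry_group M d)"
  unfolding carrier_isometry_group
  by (auto simp: bij_betw_compose compose_eq dest: bij_betwE)

lemma inverse_in_isometry_group:
  assumes "g \<in> carrier (isometry_group M d)"
  shows "restrict (inv_into M g) M \<in> carrier (isometry_group M d)"
proof -
  have g: "bij_betw g M M" "\<And>x y. x \<in> M \<Longrightarrow> y \<in> M \<Longrightarrow> d (g x) (g y) = d x y"
    using assms by (auto simp: carrier_isometry_group)
  have "bij_betw (inv_into M g) M M" by (rule bij_betw_inv_into[OF g(1)])
  moreover have "d (inv_into M g x) (inv_into M g y) = d x y" if "x \<in> M" "y \<in> M" for x y
    using g(2)[of "inv_into M g x" "inv_into M g y"] that bij_betwE[OF \<open>bij_betw (inv_into M g) M M\<close>]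
    by (simp add: bij_betw_inv_into_right[OF g(1)])
  ultimately show ?thesis by (simp add: carrier_isometry_group)
qed

theorem exp_kernel_equivariant_embedding:
  fixes X :: "'a set" and d :: "'a \<Rightarrow> 'a \<Rightarrow> real" and enc :: "'a \<Rightarrow> 'i"
  assumes N: "pd_kernel X (\<lambda>x y. exp (t * d x e) * exp (t * d y e) - exp (t * d x y))"
    and "e \<in> X" "0 < t" "inj enc"
    and d: "\<And>x. x \<in> X \<Longrightarrow> d x x = 0" "\<And>x y. x \<in> X \<Longrightarrow> y \<in> X \<Longrightarrow> 0 \<le> d x y"
      "\<And>x y. x \<in> X \<Longrightarrow> y \<in> X \<Longrightarrow> d x y = 0 \<Longrightarrow> x = y"
  shows "\<exists>(I :: 'i set) f \<rho>. f \<in> X \<rightarrow> hyp_space I \<and> inj_on f X \<and>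
      (\<forall>x\<in>X. \<forall>y\<in>X. cosh (hyp_dist (f x) (f y)) = exp (t * d x y)) \<and>
      \<rho> \<in> hom (isometry_group X d) (isometry_group (hyp_space I) hyp_dist) \<and>
      (\<forall>g\<in>carrier (isometry_group X d). \<forall>x\<in>X. f (g x) = \<rho> g (f x))"
proof -
  obtain \<phi> :: "'a \<Rightarrow> 'i l2" and I where
    \<phi>: "\<And>x y. x \<in> X \<Longrightarrow> y \<in> X \<Longrightarrow> inner (\<phi> x) (\<phi> y) = exp (t * d x e) * exp (t * d y e) - exp (t * d x y)"
    and supp: "\<phi> ` X \<subseteq> supp_l2 I" and unit: "unit_l2 ` I \<subseteq> closure (span (\<phi> ` X))"
    using pd_kernel_realization_indexed[OF N \<open>inj enc\<close>] by metis
  define F where "F x = (exp (t * d x e), \<phi> x)" for x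
  \<comment> \<open>The kernel vanishes at \<open>e\<close>, so \<open>e\<close> goes to the origin
    of the hyperboloid.\<close>
  have "inner (\<phi> e) (\<phi> e) = 0" using \<phi>[OF \<open>e \<in> X\<close> \<open>e \<in> X\<close>] d(1)[OF \<open>e \<in> X\<close>] by simp
  then have F_e: "F e = (1, 0)" using d(1)[OF \<open>e \<in> X\<close>] by (simp add: F_def)
  have lor_F: "lor (F x) (F y) = exp (t * d x y)" if "x \<in> X" "y \<in> X" for x y
    using \<phi>[OF that] by (simp add: F_def lor_def)
  have total: "closure (span (F ` X)) = {Y. snd Y \<in> supp_l2 I}"
    by (rule closure_span_eq_lorentz_space[where F = F, OF _ _ \<open>e \<in> X\<close> F_e]) (use supp unit in \<open>auto simp: F_def\<close>)
  let ?G = "carrier (isometry_group X d)" and ?H = "hyp_space I"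
  define T where "T g = (SOME T. extends_isometry X I F g T)" for g
  have T: "extends_isometry X I F g (T g)" if "g \<in> ?G" for g
  proof -
    have g: "bij_betw g X X" "\<And>x y. x \<in> X \<Longrightarrow> y \<in> X \<Longrightarrow> d (g x) (g y) = d x y"
      using that by (auto simp: carrier_isometry_group)
    have "g ` X = X" using g(1) by (simp add: bij_betw_def)
    moreover have "lor (F (g x)) (F (g y)) = lor (F x) (F y)" if "x \<in> X" "y \<in> X" for x y
      using g that bij_betwE[OF g(1)] by (simp add: lor_F)
    ultimately have "\<exists>T. extends_isometry X I F g T"
      by (rule extends_isometry_exists[OF total \<open>e \<in> X\<close> F_e])
    then show ?thesis unfolding T_def by (rule someI_ex)
  qed
  have T_bl: "bounded_linear (T g)" and T_F: "\<And>x. x \<in> X \<Longrightarrow> T g (F x) = F (g x)"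
    and T_supp: "\<And>Y. snd (T g Y) \<in> supp_l2 I"
    and T_lor: "\<And>Y Z. snd Y \<in> supp_l2 I \<Longrightarrow> snd Z \<in> supp_l2 I \<Longrightarrow> lor (T g Y) (T g Z) = lor Y Z" if "g \<in> ?G" for g
    using T[OF that] by (auto simp: extends_isometry_def)
  have G_in: "g x \<in> X" if "g \<in> ?G" "x \<in> X" for g x
    using that by (auto simp: carrier_isometry_group dest: bij_betwE)
  \<comment> \<open>The third operator is left general: \<open>T\<close> of a composition yields the
    homomorphism property, the identity yields inverses.\<close>
  have T_compose: "T g (T h Y) = T' Y" if "g \<in> ?G" "h \<in> ?G" "bounded_linear T'"
    "\<And>x. x \<in> X \<Longrightarrow> T' (F x) = F (g (h x))" "snd Y \<in> supp_l2 I" for g h T' Y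
  proof (rule bounded_linear_eq_on_closure_span[where S = "\<lambda>Y. T g (T h Y)" and A = "F ` X"])
    show "bounded_linear T'" by (rule that)
    show "bounded_linear (\<lambda>Y. T g (T h Y))"
      using that by (intro bounded_linear_compose[OF T_bl T_bl])
    show "T g (T h v) = T' v" if "v \<in> F ` X" for v
      using that \<open>g \<in> ?G\<close> \<open>h \<in> ?G\<close> by (auto simp: T_F G_in \<open>\<And>x. x \<in> X \<Longrightarrow> T' (F x) = F (g (h x))\<close>)
    show "Y \<in> closure (span (F ` X))" using that total by simp
  qed
  define \<rho> where "\<rho> g = restrict (class_map (T g)) ?H" for g
  define f where "f x = lor_class (F x)" for x
  have F_H: "f x \<in> ?H" if "x \<in> X" for x
    unfolding f_def hyp_space_lor_class using that supp lor_F[OF that that]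
    by (intro imageI CollectI conjI) (auto simp: F_def)
  have H_E: "\<exists>Y. P = lor_class Y \<and> snd Y \<in> supp_l2 I \<and> 0 < lor Y Y" if "P \<in> ?H" for P
    using that unfolding hyp_space_lor_class by blast
  have \<rho>_class: "\<rho> g (lor_class Y) = lor_class (T g Y)" "lor_class (T g Y) \<in> ?H"
    if "g \<in> ?G" "snd Y \<in> supp_l2 I" "0 < lor Y Y" for g Y
  proof -
    have "lor_class Y \<in> ?H" using that by (auto simp: hyp_space_lor_class)
    then show "\<rho> g (lor_class Y) = lor_class (T g Y)"
      using that by (simp add: \<rho>_def class_map_lor_class T_bl)
    show "lor_class (T g Y) \<in> ?H"
      using that by (auto simp: hyp_space_lor_class T_supp T_lor)
  qed
  have \<rho>_in: "\<rho> g P \<in> ?H" if "g \<in> ?G" "P \<in> ?H" for g P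
    using H_E[OF that(2)] \<rho>_class that(1) by metis
  have \<rho>_inverse: "\<rho> g (\<rho> h P) = P" if "g \<in> ?G" "h \<in> ?G" "\<And>x. x \<in> X \<Longrightarrow> g (h x) = x" "P \<in> ?H" for g h P
  proof -
    from H_E[OF that(4)] obtain Y where Y: "P = lor_class Y" "snd Y \<in> supp_l2 I" "0 < lor Y Y" by blast
    have "T g (T h Y) = Y"
      by (rule T_compose[of g h "\<lambda>Y. Y"]) (use that Y in auto)
    then show ?thesis using Y that by (simp add: \<rho>_class T_supp T_lor)
  qed
  have \<rho>_G: "\<rho> g \<in> carrier (isometry_group ?H hyp_dist)" if "g \<in> ?G" for g
    unfolding carrier_isometry_group
  proof (intro conjI ballI)
    show "\<rho> g \<in> extensional ?H" by (simp add: \<rho>_def)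
    let ?h = "restrict (inv_into X g) X"
    have bij: "bij_betw g X X" using that by (simp add: carrier_isometry_group)
    have h: "?h \<in> ?G" by (rule inverse_in_isometry_group[OF that])
    \<comment> \<open>Bijectivity comes from the operator of the inverse isometry, not from
      surjectivity of \<open>T g\<close> on the whole type.\<close>
    show "bij_betw (\<rho> g) ?H ?H"
    proof (rule bij_betwI)
      show "\<rho> g \<in> ?H \<rightarrow> ?H" "\<rho> ?h \<in> ?H \<rightarrow> ?H" using \<rho>_in that h by blast+
      show "\<rho> ?h (\<rho> g P) = P" if "P \<in> ?H" for P
        by (rule \<rho>_inverse[OF h \<open>g \<in> ?G\<close> _ that])
          (simp add: G_in[OF \<open>g \<in> ?G\<close>] bij_betw_inv_into_left[OF bij])
      show "\<rho> g (\<rho> ?h P) = P" if "P \<in> ?H" for P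
        by (rule \<rho>_inverse[OF \<open>g \<in> ?G\<close> h _ that]) (simp add: bij_betw_inv_into_right[OF bij])
    qed
    fix P Q assume "P \<in> ?H" "Q \<in> ?H"
    then obtain Y Z where Y: "P = lor_class Y" "snd Y \<in> supp_l2 I" "0 < lor Y Y"
      and Z: "Q = lor_class Z" "snd Z \<in> supp_l2 I" "0 < lor Z Z"
      using H_E by metis
    then show "hyp_dist (\<rho> g P) (\<rho> g Q) = hyp_dist P Q"
      using that by (simp add: \<rho>_class hyp_dist_lor_class T_lor)
  qed
  have hom: "\<rho> \<in> hom (isometry_group X d) (isometry_group ?H hyp_dist)"
  proof (rule homI)
    fix g h assume g: "g \<in> ?G" and h: "h \<in> ?G"
    have gh: "compose X g h \<in> ?G" by (rule compose_in_isometry_group[OF g h])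
    have "\<rho> (compose X g h) P = compose ?H (\<rho> g) (\<rho> h) P" for P
    proof (cases "P \<in> ?H")
      case True
      then obtain Y where Y: "P = lor_class Y" "snd Y \<in> supp_l2 I" "0 < lor Y Y" using H_E by blast
      have "T g (T h Y) = T (compose X g h) Y"
        by (rule T_compose[OF g h T_bl[OF gh] _ Y(2)]) (simp add: T_F[OF gh] compose_eq)
      then show ?thesis
        using True Y g h gh by (simp add: compose_eq \<rho>_class T_supp T_lor)
    next
      case False
      then show ?thesis by (simp add: \<rho>_def compose_def)
    qed
    then show "\<rho> (g \<otimes>\<^bsub>isometry_group X d\<^esub> h) = \<rho> g \<otimes>\<^bsub>isometry_group ?H hyp_dist\<^esub> \<rho> h"
      using g h by (simp add: mult_isometry_group \<rho>_G fun_eq_iff)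
  qed (rule \<rho>_G)
  have cosh_f: "cosh (hyp_dist (f x) (f y)) = exp (t * d x y)" if "x \<in> X" "y \<in> X" for x y
  proof -
    have "hyp_dist (f x) (f y) = arcosh (exp (t * d x y))"
      using that d(1) by (simp add: f_def hyp_dist_lor_class lor_F)
    then show ?thesis using d(2)[OF that] \<open>0 < t\<close> by simp
  qed
  have "inj_on f X"
  proof (rule inj_onI)
    fix x y assume "x \<in> X" "y \<in> X" "f x = f y"
    then have "exp (t * d x y) = 1"
      using cosh_f[of x y] hyp_dist_self[OF F_H[of y]] by simp
    then show "x = y" using d(3) \<open>x \<in> X\<close> \<open>y \<in> X\<close> \<open>0 < t\<close> by simp
  qed
  moreover have "f (g x) = \<rho> g (f x)" if "g \<in> ?G" "x \<in> X" for g x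
  proof -
    have "snd (F x) \<in> supp_l2 I" "0 < lor (F x) (F x)"
      using that supp lor_F[of x x] by (auto simp: F_def)
    then show ?thesis using that by (simp add: f_def \<rho>_class(1) T_F)
  qed
  ultimately show ?thesis
    using F_H cosh_f hom by blast
qed

theorem theorem8p5:
  fixes l :: real
    and J :: "'j set"
    and K :: "'j \<Rightarrow> 'k set"
    and b :: "'j \<Rightarrow> 'k hpoint"
    and A :: "'j \<Rightarrow> 'k hpoint set"
    and j0 :: 'j
    and X :: "('j, 'k hpoint) fp_point set"
    and dX :: "('j, 'k hpoint) fp_point \<Rightarrow> ('j, 'k hpoint) fp_point \<Rightarrow> real"
  assumes "1 < l" and "l \<le> exp 1"
    and "j0 \<in> J"
    and "\<And>j. j \<in> J \<Longrightarrow> b j \<in> hyp_space (K j)"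
    and "\<And>j. j \<in> J \<Longrightarrow> A j \<subseteq> hyp_space (K j)"
  defines "X \<equiv> free_product J (\<lambda>j. hyp_space (K j)) b A j0"
    and "dX \<equiv> fp_dist (\<lambda>j. hyp_dist) b j0"
  shows "\<exists>(I :: (('j, 'k hpoint) fp_point \<Rightarrow> real) set) f \<rho>.
           f \<in> X \<rightarrow> hyp_space I \<and> inj_on f X \<and>
           (\<forall>x\<in>X. \<forall>y\<in>X. cosh (hyp_dist (f x) (f y)) = l powr dX x y) \<and>
           \<rho> \<in> hom (isometry_group X dX) (isometry_group (hyp_space I) hyp_dist) \<and>
           (\<forall>g\<in>carrier (isometry_group X dX). \<forall>x\<in>X. f (g x) = \<rho> g (f x))"
proof -
  \<comment> \<open>With t = ln l the function exp (t d) is \<open>l powr d\<close>, and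
    \<open>l \<le> exp 1\<close> says exactly that t \<le> 1.\<close>
  have t: "0 < ln l" "ln l \<le> 1"
    using assms(1,2) ln_le_cancel_iff[of l "exp 1"] by simp_all
  interpret glued_spaces J "\<lambda>j. hyp_space (K j)" "\<lambda>j. hyp_dist" b A j0 "ln l"
  proof
    show "pd_kernel (hyp_space (K j)) (\<lambda>P Q. exp (ln l * hyp_dist P (b j)) * exp (ln l * hyp_dist Q (b j))
        - exp (ln l * hyp_dist P Q))" if "j \<in> J" for j
      by (rule hyp_space_exp_kernel[OF assms(4)[OF that] t])
    show "p = q" if "p \<in> hyp_space (K j)" "q \<in> hyp_space (K j)" "hyp_dist p q = 0" for j p q
      using that by (rule hyp_dist_eq_0)
  qed (simp_all add: assms(3-5) hyp_dist_self hyp_dist_nonneg hyp_dist_commute)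
  \<comment> \<open>Indicator functions of points embed the points into the prescribed index
    type.\<close>
  define enc :: "('j, 'k hpoint) fp_point \<Rightarrow> ('j, 'k hpoint) fp_point \<Rightarrow> real"
    where "enc x y = (if y = x then 1 else 0)" for x y
  have "inj enc" by (rule injI) (metis enc_def zero_neq_one)
  have powr: "exp (ln l * s) = l powr s" for s
    using assms(1) by (simp add: powr_def mult.commute)
  show ?thesis
    unfolding X_def dX_def
    using exp_kernel_equivariant_embedding[OF free_product_exp_kernel base_in t(1) \<open>inj enc\<close>
        fp_dist_self fp_dist_nonneg fp_dist_eq_0]
    unfolding powr by blast
qed

end
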